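(* Let $H^r_3$ denote the $r$-graph with $r+1$ vertices and $3$ edges (unique up to isomorphism). Then, as $r\to\infty$, $$\pi(H^r_3)=\Omega\left(\frac{\sqrt{\log r}}{r^2}\right),$$ that is, there exist constants $c>0$ and $r_0$ such that $\pi(H_3^r)\ge c\,\sqrt{\log r}/r^2$ for all integers $r\ge r_0$.
   Context: An $r$-graph is a hypergraph in which every edge is a set of exactly $r$ vertices. For an $r$-graph $H$, an $r$-graph is $H$-free if it contains no (not necessarily induced) subhypergraph isomorphic to $H$; $\mathrm{ex}(n,H)$ is the maximum number of edges in an $H$-free $r$-graph on $n$ vertices, and the Turán density of $H$ is $\pi(H)=\lim_{n\to\infty}\mathrm{ex}(n,H)/\binom{n}{r}$ (this limit always exists). *)

theory Defs
  imports Complex_Main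
begin

record 'a hypergraph =
  verts :: "'a set"
  edges :: "'a set set"

definition r_graph :: "nat \<Rightarrow> 'a hypergraph \<Rightarrow> bool" where
  "r_graph r H \<longleftrightarrow> finite (verts H) \<and> (\<forall>e\<in>edges H. e \<subseteq> verts H \<and> card e = r)"

definition subhypergraph :: "'a hypergraph \<Rightarrow> 'a hypergraph \<Rightarrow> bool" where
  "subhypergraph K G \<longleftrightarrow>
     verts K \<subseteq> verts G \<and> edges K \<subseteq> edges G \<and> (\<forall>e\<in>edges K. e \<subseteq> verts K)"

definition isomorphic :: "'a hypergraph \<Rightarrow> 'b hypergraph \<Rightarrow> bool" where
  "isomorphic H K \<longleftrightarrow>
     (\<exists>f. bij_betw f (verts H) (verts K) \<and> (\<lambda>e. f ` e) ` edges H = edges K)"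

definition H_free :: "'a hypergraph \<Rightarrow> 'b hypergraph \<Rightarrow> bool" where
  "H_free H G \<longleftrightarrow> \<not> (\<exists>K. subhypergraph K G \<and> isomorphic H K)"

text \<open>The uniformity \<open>r\<close> is an explicit argument below, since an edgeless \<open>H\<close> does not
  determine it. Host graphs have vertices in \<^typ>\<open>nat\<close>, which realises every finite
  \<open>r\<close>-graph up to isomorphism. If \<open>H\<close> has an edge, the set under \<^const>\<open>Max\<close> is
  finite and contains 0.\<close>

definition ex_turan :: "nat \<Rightarrow> nat \<Rightarrow> 'a hypergraph \<Rightarrow> nat" where
  "ex_turan r n H =
     Max {card (edges G) | G :: nat hypergraph.
            r_graph r G \<and> card (verts G) = n \<and> H_free H G}"

definition turan_density :: "nat \<Rightarrow> 'a hypergraph \<Rightarrow> real" where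
  "turan_density r H = lim (\<lambda>n. real (ex_turan r n H) / real (n choose r))"

definition is_H3 :: "nat \<Rightarrow> 'a hypergraph \<Rightarrow> bool" where
  "is_H3 r H \<longleftrightarrow> r_graph r H \<and> card (verts H) = r + 1 \<and> card (edges H) = 3"

lemma is_H3_exists:
  assumes "r \<ge> 2"
  shows "\<exists>H :: nat hypergraph. is_H3 r H"
proof -
  let ?e = "\<lambda>i::nat. {..r} - {i}"
  let ?H = "\<lparr>verts = {..r}, edges = ?e ` {..<3}\<rparr> :: nat hypergraph"
  have "inj_on ?e {..<3}"
    using assms by (intro inj_onI) fastforce
  then have "card (edges ?H) = 3"
    by (simp add: card_image)
  moreover have "r_graph r ?H"
    using assms by (auto simp: r_graph_def)
  ultimately show ?thesis
    unfolding is_H3_def by (intro exI[of _ ?H]) simp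
qed

lemma is_H3_edges:
  assumes "is_H3 r H"
  obtains S where "S \<subseteq> verts H" "card S = 3" "edges H = (\<lambda>x. verts H - {x}) ` S"
proof -
  let ?V = "verts H"
  define S where "S = {x \<in> ?V. ?V - {x} \<in> edges H}"
  have fin: "finite ?V" and c: "card ?V = r + 1" "card (edges H) = 3"
    and e: "\<And>e. e \<in> edges H \<Longrightarrow> e \<subseteq> ?V \<and> card e = r"
    using assms by (auto simp: is_H3_def r_graph_def)
  have E: "edges H = (\<lambda>x. ?V - {x}) ` S"
  proof (intro equalityI subsetI)
    fix e assume a: "e \<in> edges H"
    then have "card (?V - e) = 1"
      using e[OF a] c fin card_Diff_subset[of e ?V] finite_subset[of e ?V] by simp
    then obtain x where x: "?V - e = {x}" by (auto simp: card_1_singleton_iff)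
    then have "x \<in> ?V" "?V - {x} = e" using e[OF a] by auto
    then show "e \<in> (\<lambda>x. ?V - {x}) ` S" using a by (auto simp: S_def)
  qed (auto simp: S_def)
  moreover have "inj_on (\<lambda>x. ?V - {x}) S"
    by (intro inj_onI) (auto simp: S_def)
  ultimately have "card S = 3"
    using c(2) card_image[of "\<lambda>x. ?V - {x}" S] by simp
  moreover have "S \<subseteq> ?V" by (auto simp: S_def)
  ultimately show ?thesis using that E by blast
qed

lemma is_H3_unique:
  assumes H: "is_H3 r H" and K: "is_H3 r K"
  shows "isomorphic H K"
proof -
  obtain S where S: "S \<subseteq> verts H" "card S = 3" "edges H = (\<lambda>x. verts H - {x}) ` S"
    using is_H3_edges[OF H] .
  obtain T where T: "T \<subseteq> verts K" "card T = 3" "edges K = (\<lambda>x. verts K - {x}) ` T"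
    using is_H3_edges[OF K] .
  have fin: "finite (verts H)" "finite (verts K)" and c: "card (verts H) = card (verts K)"
    using H K by (auto simp: is_H3_def r_graph_def)
  have finS: "finite S" "finite T"
    using finite_subset[OF S(1) fin(1)] finite_subset[OF T(1) fin(2)] by auto
  obtain f where f: "bij_betw f S T"
    using finite_same_card_bij[OF finS] S(2) T(2) by auto
  have "card (verts H - S) = card (verts K - T)"
    using card_Diff_subset[OF finS(1) S(1)] card_Diff_subset[OF finS(2) T(1)] S(2) T(2) c by simp
  then obtain g where g: "bij_betw g (verts H - S) (verts K - T)"
    using finite_same_card_bij[of "verts H - S" "verts K - T"] fin by auto
  define h where "h = (\<lambda>x. if x \<in> S then f x else g x)"
  have hS: "bij_betw h S T"
    using f by (subst bij_betw_cong[of _ _ f]) (auto simp: h_def)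
  have "bij_betw h (verts H - S) (verts K - T)"
    using g by (subst bij_betw_cong[of _ _ g]) (auto simp: h_def)
  with hS have "bij_betw h (S \<union> (verts H - S)) (T \<union> (verts K - T))"
    by (rule bij_betw_combine) auto
  moreover have "S \<union> (verts H - S) = verts H" "T \<union> (verts K - T) = verts K"
    using S(1) T(1) by auto
  ultimately have h: "bij_betw h (verts H) (verts K)" by simp
  have im: "h ` (verts H - {x}) = verts K - {h x}" if "x \<in> S" for x
    using inj_on_image_set_diff[of h "verts H" "verts H" "{x}"] h that S(1)
    by (auto simp: bij_betw_def)
  have "(\<lambda>e. h ` e) ` edges H = (\<lambda>x. h ` (verts H - {x})) ` S"
    by (simp add: S(3) image_image)
  also have "\<dots> = (\<lambda>x. verts K - {h x}) ` S" by (intro image_cong refl im)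
  also have "\<dots> = (\<lambda>y. verts K - {y}) ` (h ` S)" by (simp add: image_image)
  also have "\<dots> = edges K" using bij_betw_imp_surj_on[OF hS] T(3) by simp
  finally show ?thesis using h unfolding isomorphic_def by blast
qed

end

theory Submission
  imports Defs "HOL-Library.FuncSet"
begin

text \<open>Call three \<open>r\<close>-subsets of \<open>{..<m}\<close> with union of size \<open>r + 1\<close> a triple. A family of
  \<open>r\<close>-sets without triples is \<open>H3\<close>-free, and so is its blow-up, because any two vertices of
  \<open>H3\<close> lie in a common edge. For \<open>m = 2 r\<^sup>2\<close> the blow-up loses only a constant factor in
  density, so it suffices to find a triple-free family of density of order
  \<open>sqrt (ln r) / r\<^sup>2\<close>.

  A random family of density \<open>q = r powr (-15/8)\<close> spans a 3-graph of triples with maximum degree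
  \<open>d\<close> of order \<open>r\<^sup>4 q\<^sup>2\<close>, which after few deletions is linear and triangle-free. By a theorem
  of Ajtai, Komlos, Pintz, Spencer and Szemeredi, such a 3-graph on \<open>N\<close> vertices has an independent
  set of size of order \<open>N sqrt (ln d / d)\<close>; this logarithmic gain is the one claimed.

  The independent set is a random one, drawn from a hard-core model in which pairs of occupied
  vertices in a common edge carry the penalty \<open>1 - \<tau>\<close> with \<open>\<tau> = sqrt (ln d / d)\<close>. Conditioned on
  everything outside the neighbourhood of \<open>v\<close>, the edges at \<open>v\<close> are independent, so \<open>v\<close> is free
  with probability at least the exponential of minus a multiple of the expected number of edges at
  \<open>v\<close> whose other two vertices are occupied. The penalty bounds this expected number by
  \<open>sqrt (d ln d)\<close> times the density of the set, up to a negligible term, so the density cannot be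
  smaller than a multiple of \<open>sqrt (ln d / d)\<close>.\<close>

section \<open>Product weights on subsets\<close>

lemma sum_Pow_Un:
  fixes F :: "'a set \<Rightarrow> 'b::comm_monoid_add"
  assumes "finite A" "finite B" "A \<inter> B = {}"
  shows "(\<Sum>X\<in>Pow (A \<union> B). F X) = (\<Sum>X\<in>Pow A. \<Sum>Y\<in>Pow B. F (X \<union> Y))"
proof -
  have "(\<Sum>X\<in>Pow (A \<union> B). F X) = (\<Sum>(X, Y)\<in>Pow A \<times> Pow B. F (X \<union> Y))"
    using assms(3)
    by (intro sum.reindex_bij_witness[where i = "\<lambda>(X, Y). X \<union> Y" and j = "\<lambda>X. (X \<inter> A, X \<inter> B)"])
      (auto simp: Int_Un_distrib2 Int_absorb2 intro!: arg_cong[where f = F])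
  then show ?thesis
    by (simp add: sum.cartesian_product)
qed

lemma sum_Pow_insert:
  fixes F :: "'a set \<Rightarrow> 'b::comm_monoid_add"
  assumes "finite A" "x \<notin> A"
  shows "(\<Sum>X\<in>Pow (insert x A). F X) = (\<Sum>X\<in>Pow A. F X) + (\<Sum>X\<in>Pow A. F (insert x X))"
proof -
  have "(\<Sum>X\<in>Pow (A \<union> {x}). F X) = (\<Sum>X\<in>Pow A. F X + F (insert x X))"
    using assms by (subst sum_Pow_Un) (auto simp: Pow_insert add.commute)
  then show ?thesis
    by (simp add: sum.distrib)
qed

text \<open>Independence of disjoint blocks: a subset of the union is a free choice of one subset
  per block, so the total of a product weight factors.\<close>

lemma sum_Pow_UN_prod:
  fixes h :: "'k \<Rightarrow> 'a set \<Rightarrow> 'b::comm_semiring_1"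
  assumes "finite K" "\<And>k. k \<in> K \<Longrightarrow> finite (P k)"
    and "\<And>k l. k \<in> K \<Longrightarrow> l \<in> K \<Longrightarrow> k \<noteq> l \<Longrightarrow> P k \<inter> P l = {}"
  shows "(\<Sum>J\<in>Pow (\<Union>k\<in>K. P k). \<Prod>k\<in>K. h k (J \<inter> P k)) = (\<Prod>k\<in>K. \<Sum>S\<in>Pow (P k). h k S)"
  using assms
proof (induction K rule: finite_induct)
  case empty
  then show ?case by simp
next
  case (insert k K)
  let ?U = "\<Union>l\<in>K. P l"
  have disj: "?U \<inter> P k = {}"
    using insert.hyps insert.prems(2) by fastforce
  have disj': "P l \<inter> P k = {}" if "l \<in> K" for l
    using disj that by blast
  have "(\<Sum>J\<in>Pow (\<Union>l\<in>insert k K. P l). \<Prod>l\<in>insert k K. h l (J \<inter> P l))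
      = (\<Sum>J\<in>Pow (?U \<union> P k). \<Prod>l\<in>insert k K. h l (J \<inter> P l))"
    by (simp add: Un_commute)
  also have "\<dots> = (\<Sum>J\<in>Pow ?U. \<Sum>S\<in>Pow (P k). \<Prod>l\<in>insert k K. h l ((J \<union> S) \<inter> P l))"
    using insert.hyps insert.prems disj by (intro sum_Pow_Un) auto
  also have "\<dots> = (\<Sum>J\<in>Pow ?U. \<Sum>S\<in>Pow (P k). h k S * (\<Prod>l\<in>K. h l (J \<inter> P l)))"
  proof (intro sum.cong refl)
    fix J S assume J: "J \<in> Pow ?U" and S: "S \<in> Pow (P k)"
    have "(J \<union> S) \<inter> P k = S"
      using J S disj by blast
    moreover have "(J \<union> S) \<inter> P l = J \<inter> P l" if "l \<in> K" for l
      using S disj'[OF that] by blast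
    ultimately show "(\<Prod>l\<in>insert k K. h l ((J \<union> S) \<inter> P l)) = h k S * (\<Prod>l\<in>K. h l (J \<inter> P l))"
      using insert.hyps by (simp cong: prod.cong)
  qed
  also have "\<dots> = (\<Sum>S\<in>Pow (P k). h k S) * (\<Sum>J\<in>Pow ?U. \<Prod>l\<in>K. h l (J \<inter> P l))"
    by (simp add: sum_distrib_left sum_distrib_right)
  also have "(\<Sum>J\<in>Pow ?U. \<Prod>l\<in>K. h l (J \<inter> P l)) = (\<Prod>l\<in>K. \<Sum>S\<in>Pow (P l). h l S)"
    using insert.prems by (intro insert.IH) auto
  finally show ?case
    using insert.hyps by simp
qed

text \<open>A convex function lies above its tangents; \<open>s\<close> is the point of
  tangency.\<close>

lemma exp_tangent_le: "exp (- s) * (1 + s - x) \<le> exp (- x)" for s x :: real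
proof -
  have "exp (- s) * (1 + s - x) \<le> exp (- s) * exp (s - x)"
    using exp_ge_add_one_self[of "s - x"] by (intro mult_left_mono) (simp_all add: algebra_simps)
  then show ?thesis by (simp flip: exp_add)
qed

text \<open>The range comes from \<open>(1 - x) * (1 + 2 * x) = 1 + x * (1 - 2 * x)\<close>, which
  is at least 1 there.\<close>

lemma one_minus_ge_exp: "0 \<le> x \<Longrightarrow> x \<le> 1/2 \<Longrightarrow> exp (- 2 * x) \<le> 1 - x" for x :: real
proof -
  assume x: "0 \<le> x" "x \<le> 1/2"
  have "1 \<le> (1 - x) * (1 + 2 * x)"
    using x mult_left_mono[of x "1/2" x] by (auto simp: algebra_simps)
  also have "\<dots> \<le> (1 - x) * exp (2 * x)"
    using x exp_ge_add_one_self[of "2*x"] by (intro mult_left_mono) auto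
  finally show ?thesis
    by (simp add: exp_minus field_simps)
qed

text \<open>Under the product weight \<open>\<Prod>\<^sub>k h k\<close>, the right-hand side is the tangent at \<open>s\<close> of
  \<open>exp (- 2 * E)\<close>, where \<open>E\<close> is the mean of \<open>\<Sum>\<^sub>k F k\<close>; replacing the exponential by its
  tangent makes the bound linear in the weights.\<close>

lemma product_weight_tangent_bound:
  fixes h g F :: "'k \<Rightarrow> 'a set \<Rightarrow> real"
  assumes K: "finite K" "\<And>k. k \<in> K \<Longrightarrow> finite (P k)"
    and disj: "\<And>k l. k \<in> K \<Longrightarrow> l \<in> K \<Longrightarrow> k \<noteq> l \<Longrightarrow> P k \<inter> P l = {}"
    and H: "\<And>k. k \<in> K \<Longrightarrow> 0 < (\<Sum>S\<in>Pow (P k). h k S)"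
    and F: "\<And>k. k \<in> K \<Longrightarrow> 0 \<le> (\<Sum>S\<in>Pow (P k). h k S * F k S)"
    and F_le: "\<And>k. k \<in> K \<Longrightarrow> 2 * (\<Sum>S\<in>Pow (P k). h k S * F k S) \<le> (\<Sum>S\<in>Pow (P k). h k S)"
    and g: "\<And>k. k \<in> K \<Longrightarrow>
      (\<Sum>S\<in>Pow (P k). h k S) - (\<Sum>S\<in>Pow (P k). h k S * F k S) \<le> (\<Sum>S\<in>Pow (P k). g k S)"
  shows "exp (- s) * ((1 + s) * (\<Sum>J\<in>Pow (\<Union>k\<in>K. P k). \<Prod>k\<in>K. h k (J \<inter> P k))
      - 2 * (\<Sum>J\<in>Pow (\<Union>k\<in>K. P k). (\<Prod>k\<in>K. h k (J \<inter> P k)) * (\<Sum>k\<in>K. F k (J \<inter> P k))))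
    \<le> (\<Sum>J\<in>Pow (\<Union>k\<in>K. P k). \<Prod>k\<in>K. g k (J \<inter> P k))"
proof -
  define H where "H k = (\<Sum>S\<in>Pow (P k). h k S)" for k
  define M where "M k = (\<Sum>S\<in>Pow (P k). h k S * F k S)" for k
  let ?U = "\<Union>k\<in>K. P k"
  have Hpos: "H k > 0" if "k \<in> K" for k
    using H that by (simp add: H_def)
  have "(\<Sum>J\<in>Pow ?U. (\<Prod>k\<in>K. h k (J \<inter> P k)) * F l (J \<inter> P l)) = prod H K * (M l / H l)"
    if l: "l \<in> K" for l
  proof -
    \<comment> \<open>Absorbing the factor \<open>F l\<close> into the weight of block
      \<open>l\<close> keeps the product form, so the mean of a single summand factors as
      well.\<close>
    define h' where "h' k S = (if k = l then h k S * F k S else h k S)" for k S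
    have "(\<Prod>k\<in>K. h k (J \<inter> P k)) * F l (J \<inter> P l) = (\<Prod>k\<in>K. h' k (J \<inter> P k))" for J
    proof -
      have "(\<Prod>k\<in>K. h' k (J \<inter> P k)) = h' l (J \<inter> P l) * (\<Prod>k\<in>K - {l}. h' k (J \<inter> P k))"
        using K(1) l by (rule prod.remove)
      also have "\<dots> = F l (J \<inter> P l) * (h l (J \<inter> P l) * (\<Prod>k\<in>K - {l}. h k (J \<inter> P k)))"
        by (simp add: h'_def)
      also have "h l (J \<inter> P l) * (\<Prod>k\<in>K - {l}. h k (J \<inter> P k)) = (\<Prod>k\<in>K. h k (J \<inter> P k))"
        using prod.remove[OF K(1) l, of "\<lambda>k. h k (J \<inter> P k)"] by simp
      finally show ?thesis by (simp add: mult.commute)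
    qed
    then have "(\<Sum>J\<in>Pow ?U. (\<Prod>k\<in>K. h k (J \<inter> P k)) * F l (J \<inter> P l))
        = (\<Prod>k\<in>K. \<Sum>S\<in>Pow (P k). h' k S)"
      using K disj by (simp add: sum_Pow_UN_prod)
    also have "\<dots> = M l * (\<Prod>k\<in>K - {l}. H k)"
      by (subst prod.remove[OF K(1) l]) (simp add: h'_def M_def H_def)
    also have "\<dots> = prod H K * (M l / H l)"
      using Hpos[OF l] by (subst prod.remove[OF K(1) l]) simp
    finally show ?thesis .
  qed
  then have cost: "(\<Sum>J\<in>Pow ?U. (\<Prod>k\<in>K. h k (J \<inter> P k)) * (\<Sum>k\<in>K. F k (J \<inter> P k)))
      = prod H K * (\<Sum>k\<in>K. M k / H k)"
    by (simp add: sum_distrib_left) (subst sum.swap, simp)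
  have tot: "(\<Sum>J\<in>Pow ?U. \<Prod>k\<in>K. h k (J \<inter> P k)) = prod H K"
    using K disj by (simp add: sum_Pow_UN_prod H_def)
  let ?x = "\<Sum>k\<in>K. 2 * (M k / H k)"
  have "exp (- s) * ((1 + s) * prod H K - 2 * (prod H K * (\<Sum>k\<in>K. M k / H k)))
      = prod H K * (exp (- s) * (1 + s - ?x))"
    by (simp add: algebra_simps sum_distrib_left)
  also have "\<dots> \<le> prod H K * exp (- ?x)"
    using exp_tangent_le Hpos by (intro mult_left_mono prod_nonneg) (auto intro: less_imp_le)
  also have "\<dots> = (\<Prod>k\<in>K. H k * exp (- 2 * (M k / H k)))"
    using K(1) by (simp add: prod.distrib exp_sum sum_negf[symmetric])
  also have "\<dots> \<le> (\<Prod>k\<in>K. \<Sum>S\<in>Pow (P k). g k S)"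
  proof (intro prod_mono conjI)
    fix k assume k: "k \<in> K"
    \<comment> \<open>\<open>F_le\<close> says that the mean \<open>M k / H k\<close> is at most
      1/2, the range of \<open>one_minus_ge_exp\<close>.\<close>
    have "H k * exp (- 2 * (M k / H k)) \<le> H k * (1 - M k / H k)"
      using Hpos[OF k] F[OF k] F_le[OF k]
      by (intro mult_left_mono one_minus_ge_exp) (auto simp: M_def H_def field_simps)
    also have "\<dots> = H k - M k"
      using Hpos[OF k] by (simp add: field_simps)
    also have "\<dots> \<le> (\<Sum>S\<in>Pow (P k). g k S)"
      using g[OF k] by (simp add: H_def M_def)
    finally show "H k * exp (- 2 * (M k / H k)) \<le> (\<Sum>S\<in>Pow (P k). g k S)" .
    show "0 \<le> H k * exp (- 2 * (M k / H k))"
      using Hpos[OF k] by simp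
  qed
  also have "\<dots> = (\<Sum>J\<in>Pow ?U. \<Prod>k\<in>K. g k (J \<inter> P k))"
    using K disj by (simp add: sum_Pow_UN_prod)
  finally show ?thesis
    by (simp add: tot cost)
qed

section \<open>Independent sets in linear triangle-free 3-graphs\<close>

text \<open>By \<open>linear\<close> the edges at \<open>v\<close> are disjoint apart from
  \<open>v\<close>, and by \<open>triangle_free\<close> no edge meets two of them outside
  \<open>v\<close>. This is the independence that the local estimate at \<open>v\<close> rests
  on.\<close>

locale sparse_3graph =
  fixes V :: "'a set" and T :: "'a set set" and d :: real
  assumes finite_V: "finite V"
    and edge_subset: "e \<in> T \<Longrightarrow> e \<subseteq> V"
    and edge_card: "e \<in> T \<Longrightarrow> card e = 3"
    and linear: "\<lbrakk>e \<in> T; f \<in> T; u \<in> e; u \<in> f; w \<in> e; w \<in> f; u \<noteq> w\<rbrakk> \<Longrightarrow> e = f"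
    and triangle_free: "\<lbrakk>e \<in> T; f \<in> T; e \<noteq> f; v \<in> e; v \<in> f; u \<in> e; u \<noteq> v; w \<in> f; w \<noteq> v;
      g \<in> T; u \<in> g; w \<in> g\<rbrakk> \<Longrightarrow> False"
    and degree_le: "v \<in> V \<Longrightarrow> real (card {e \<in> T. v \<in> e}) \<le> d"
begin

lemma finite_T: "finite T"
  using edge_subset finite_V by (intro finite_subset[of T "Pow V"]) auto

lemma finite_edge: "e \<in> T \<Longrightarrow> finite e"
  using edge_subset finite_V finite_subset by blast

end

text \<open>The hard-core model with fugacity \<open>1/8\<close>, with an additional factor \<open>1 - \<tau>\<close> for
  each edge that contains two occupied vertices.\<close>

definition edge_wt :: "real \<Rightarrow> nat \<Rightarrow> real" where
  "edge_wt \<tau> n = (if n \<le> 1 then 1 else if n = 2 then 1 - \<tau> else 0)"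

lemma edge_wt_simps [simp]:
  "edge_wt \<tau> 0 = 1" "edge_wt \<tau> (Suc 0) = 1"
  "edge_wt \<tau> (Suc (Suc 0)) = 1 - \<tau>" "edge_wt \<tau> (Suc (Suc (Suc 0))) = 0"
  by (simp_all add: edge_wt_def)

section \<open>The hard-core model with pair penalties and its local estimate at a vertex\<close>

locale weighted_3graph = sparse_3graph +
  fixes \<tau> :: real
  assumes tau_nonneg: "0 \<le> \<tau>" and tau_less: "\<tau> < 1"
begin

definition wt :: "'a set \<Rightarrow> real" where
  "wt I = (1/8) ^ card I * (\<Prod>e\<in>T. edge_wt \<tau> (card (e \<inter> I)))"

text \<open>An upper bound, edge by edge, for the relative weight lost when a free \<open>v\<close>
  becomes occupied: an edge with one other occupied vertex loses the fraction \<tau>, and an edge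
  with two loses everything.\<close>

definition cost :: "'a \<Rightarrow> 'a set \<Rightarrow> real" where
  "cost v I = (\<Sum>e | e \<in> T \<and> v \<in> e. \<tau> * card (e \<inter> I) + (if e - {v} \<subseteq> I then 1 else 0))"

lemma edge_wt_nonneg: "0 \<le> edge_wt \<tau> n"
  using tau_less by (simp add: edge_wt_def)

lemma edge_wt_pos: "n \<le> 2 \<Longrightarrow> 0 < edge_wt \<tau> n"
  using tau_less by (simp add: edge_wt_def)

lemma edge_wt_antimono: "m \<le> n \<Longrightarrow> edge_wt \<tau> n \<le> edge_wt \<tau> m"
  using tau_nonneg tau_less by (simp add: edge_wt_def)

lemma wt_nonneg: "0 \<le> wt I"
  by (auto simp: wt_def intro!: mult_nonneg_nonneg prod_nonneg edge_wt_nonneg)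

lemma wt_empty: "wt {} = 1"
  by (simp add: wt_def)

lemma wt_insert_le:
  assumes "I \<subseteq> V" "v \<notin> I"
  shows "wt (insert v I) \<le> (1/8) * wt I"
proof -
  have fin: "finite I" using assms(1) finite_V finite_subset by blast
  have "(\<Prod>e\<in>T. edge_wt \<tau> (card (e \<inter> insert v I))) \<le> (\<Prod>e\<in>T. edge_wt \<tau> (card (e \<inter> I)))"
    using fin finite_edge edge_wt_nonneg
    by (intro prod_mono conjI edge_wt_antimono card_mono) auto
  then show ?thesis
    using fin assms(2) by (simp add: wt_def mult_left_mono)
qed

text \<open>Fix the configuration \<omega> outside \<open>v\<close> and its neighbourhood
  \<open>N\<close>. The pairs \<open>P k\<close> partition \<open>N\<close> and no edge meets two of
  them, so the weight on \<open>N\<close> is a product over the edges \<open>k\<close> at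
  \<open>v\<close> and \<open>product_weight_tangent_bound\<close> applies. The tangent form is
  linear in the weights, which allows summation over \<omega>.\<close>

lemma sum_wt_insert_ge:
  assumes v: "v \<in> V"
  shows "exp (- s) / 8 * ((1 + s) * (\<Sum>I\<in>Pow (V - {v}). wt I)
      - 2 * (\<Sum>I\<in>Pow (V - {v}). wt I * cost v I)) \<le> (\<Sum>I\<in>Pow (V - {v}). wt (insert v I))"
proof -
  define K where "K = {e \<in> T. v \<in> e}"
  define P where "P e = e - {v}" for e :: "'a set"
  define N where "N = (\<Union>k\<in>K. P k)"
  define R where "R = V - {v} - N"
  define E where "E k = {e \<in> T. e \<inter> P k \<noteq> {}}" for k :: "'a set"
  have finK: "finite K" using finite_T by (simp add: K_def)
  have finP: "finite (P k)" if "k \<in> K" for k using finite_edge that by (auto simp: P_def K_def)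
  have cardP: "card (P k) = 2" if "k \<in> K" for k
    using edge_card finite_edge that by (auto simp: P_def K_def)
  have disjP: "P k \<inter> P l = {}" if "k \<in> K" "l \<in> K" "k \<noteq> l" for k l
    using linear[of k l v] that by (auto simp: P_def K_def)
  have finR: "finite R" using finite_V by (simp add: R_def)
  have finN: "finite N" using finK finP by (auto simp: N_def)
  have RN: "V - {v} = R \<union> N" "R \<inter> N = {}"
    using edge_subset by (fastforce simp: R_def N_def P_def K_def)+
  \<comment> \<open>An edge meeting both \<open>P k\<close> and \<open>P l\<close> would close a
    triangle with corner \<open>v\<close>.\<close>
  have disjE: "E k \<inter> E l = {}" if k: "k \<in> K" and l: "l \<in> K" and kl: "k \<noteq> l" for k l
  proof (rule ccontr)
    assume "E k \<inter> E l \<noteq> {}"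
    then obtain e u w where e: "e \<in> T" "u \<in> e" "u \<in> P k" "w \<in> e" "w \<in> P l"
      by (auto simp: E_def)
    then show False
      using k l kl triangle_free[of k l v u w e] by (auto simp: P_def K_def)
  qed
  \<comment> \<open>The remaining edges avoid both \<open>v\<close> and \<open>N\<close>, so their
    factors depend on \<omega> alone and go into the constant \<open>C\<close>.\<close>
  define E0 where "E0 = T - (\<Union>k\<in>K. E k)"
  have E0_v: "v \<notin> e" if "e \<in> E0" for e
  proof
    assume "v \<in> e"
    then have "e \<in> K" using that by (auto simp: E0_def K_def)
    moreover from this have "e \<inter> P e \<noteq> {}"
      using cardP[of e] by (metis P_def Diff_subset Int_absorb1 card.empty zero_neq_numeral)
    ultimately show False using that by (auto simp: E0_def E_def)
  qed
  have E0_N: "e \<inter> N = {}" if "e \<in> E0" for e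
    using that by (auto simp: E0_def E_def N_def)
  have split: "(\<Prod>e\<in>T. f e) = (\<Prod>e\<in>E0. f e) * (\<Prod>k\<in>K. \<Prod>e\<in>E k. f e)" for f :: "'a set \<Rightarrow> real"
  proof -
    have "(\<Prod>e\<in>T. f e) = (\<Prod>e\<in>E0. f e) * (\<Prod>e\<in>(\<Union>k\<in>K. E k). f e)"
      using finite_T unfolding E0_def by (intro prod.subset_diff) (auto simp: E_def)
    also have "(\<Prod>e\<in>(\<Union>k\<in>K. E k). f e) = (\<Prod>k\<in>K. \<Prod>e\<in>E k. f e)"
      using finK finite_T disjE by (intro prod.UNION_disjoint) (auto simp: E_def)
    finally show ?thesis .
  qed
  \<comment> \<open>An edge of \<open>E k\<close> sees only the part of \<open>J\<close> that lies
    in block \<open>P k\<close>; this gives the product form.\<close>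
  have meet: "e \<inter> J = e \<inter> (J \<inter> P k)" if "k \<in> K" "e \<in> E k" "J \<subseteq> N" for e J k
  proof -
    have "x \<in> P k" if x: "x \<in> e" "x \<in> J" for x
    proof -
      have "x \<in> N" using \<open>J \<subseteq> N\<close> x by auto
      then obtain l where l: "l \<in> K" "x \<in> P l" by (auto simp: N_def)
      then have "e \<in> E l" using \<open>e \<in> E k\<close> x by (auto simp: E_def)
      then have "k = l" using disjE[OF \<open>k \<in> K\<close> l(1)] \<open>e \<in> E k\<close> by auto
      then show ?thesis using l by simp
    qed
    then show ?thesis by auto
  qed
  define F where "F k S = \<tau> * card S + (if S = P k then 1 else 0)" for k S
  have cost: "cost v (\<omega> \<union> J) = (\<Sum>k\<in>K. F k (J \<inter> P k))" if "\<omega> \<subseteq> R" "J \<subseteq> N" for \<omega> J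
    unfolding cost_def K_def[symmetric]
  proof (intro sum.cong refl)
    fix k assume k: "k \<in> K"
    have "P k \<subseteq> N" using k by (auto simp: N_def)
    have k_eq: "k = insert v (P k)" using k by (auto simp: P_def K_def)
    have "v \<notin> N" by (auto simp: N_def P_def)
    have "\<omega> \<inter> insert v N = {}" using that by (auto simp: R_def)
    then have "insert v (P k) \<inter> (\<omega> \<union> J) = J \<inter> P k"
      using that \<open>v \<notin> N\<close> \<open>P k \<subseteq> N\<close> by blast
    then have "k \<inter> (\<omega> \<union> J) = J \<inter> P k"
      using k_eq by metis
    moreover have "k - {v} \<subseteq> \<omega> \<union> J \<longleftrightarrow> J \<inter> P k = P k"
      using that \<open>P k \<subseteq> N\<close> RN(2) unfolding P_def[symmetric] by blast
    ultimately show "\<tau> * card (k \<inter> (\<omega> \<union> J)) + (if k - {v} \<subseteq> \<omega> \<union> J then 1 else 0)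
        = F k (J \<inter> P k)"
      by (simp add: F_def)
  qed
  have inner: "exp (- s) / 8 * ((1 + s) * (\<Sum>J\<in>Pow N. wt (\<omega> \<union> J))
      - 2 * (\<Sum>J\<in>Pow N. wt (\<omega> \<union> J) * cost v (\<omega> \<union> J))) \<le> (\<Sum>J\<in>Pow N. wt (insert v (\<omega> \<union> J)))"
    if \<omega>: "\<omega> \<subseteq> R" for \<omega>
  proof -
    have fin\<omega>: "finite \<omega>" using \<omega> finR finite_subset by blast
    define C where "C = (1/8) ^ card \<omega> * (\<Prod>e\<in>E0. edge_wt \<tau> (card (e \<inter> \<omega>)))"
    define h where "h k S = (1/8) ^ card S * (\<Prod>e\<in>E k. edge_wt \<tau> (card (e \<inter> (\<omega> \<union> S))))" for k S
    define g where "g k S = (1/8) ^ card S * (\<Prod>e\<in>E k. edge_wt \<tau> (card (e \<inter> insert v (\<omega> \<union> S))))"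
      for k S
    have C: "C \<ge> 0" unfolding C_def
      by (intro mult_nonneg_nonneg prod_nonneg edge_wt_nonneg) auto
    have pow: "((1::real)/8) ^ card (\<omega> \<union> J) = (1/8) ^ card \<omega> * (\<Prod>k\<in>K. (1/8) ^ card (J \<inter> P k))"
      if J: "J \<subseteq> N" for J
    proof -
      have "finite J" using J finN finite_subset by blast
      then have "card (\<omega> \<union> J) = card \<omega> + card J"
        using J \<omega> RN(2) fin\<omega> by (intro card_Un_disjoint) auto
      also have "J = (\<Union>k\<in>K. J \<inter> P k)" using J by (auto simp: N_def)
      then have "card J = card (\<Union>k\<in>K. J \<inter> P k)" by simp
      also have "\<dots> = (\<Sum>k\<in>K. card (J \<inter> P k))"
        using finK finP disjP by (intro card_UN_disjoint) auto
      finally show ?thesis by (simp add: power_add power_sum)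
    qed
    have wt: "wt (\<omega> \<union> J) = C * (\<Prod>k\<in>K. h k (J \<inter> P k))" if J: "J \<subseteq> N" for J
    proof -
      have "edge_wt \<tau> (card (e \<inter> (\<omega> \<union> J))) = edge_wt \<tau> (card (e \<inter> \<omega>))"
        if "e \<in> E0" for e
      proof -
        have "e \<inter> (\<omega> \<union> J) = e \<inter> \<omega>" using E0_N[OF that] J by auto
        then show ?thesis by simp
      qed
      moreover have "edge_wt \<tau> (card (e \<inter> (\<omega> \<union> J))) = edge_wt \<tau> (card (e \<inter> (\<omega> \<union> (J \<inter> P k))))"
        if "k \<in> K" "e \<in> E k" for e k
        using meet[OF that J] by (simp add: Int_Un_distrib)
      ultimately show ?thesis
        unfolding wt_def split C_def h_def pow[OF J] by (simp add: prod.distrib mult_ac)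
    qed
    have wt': "wt (insert v (\<omega> \<union> J)) = C / 8 * (\<Prod>k\<in>K. g k (J \<inter> P k))" if J: "J \<subseteq> N" for J
    proof -
      have vn: "v \<notin> \<omega> \<union> J" using J \<omega> by (auto simp: R_def N_def P_def)
      moreover have "finite (\<omega> \<union> J)"
        using fin\<omega> J finN finite_subset by blast
      ultimately have "card (insert v (\<omega> \<union> J)) = Suc (card (\<omega> \<union> J))" by simp
      moreover have "edge_wt \<tau> (card (e \<inter> insert v (\<omega> \<union> J))) = edge_wt \<tau> (card (e \<inter> \<omega>))"
        if "e \<in> E0" for e
      proof -
        have "e \<inter> insert v (\<omega> \<union> J) = e \<inter> \<omega>" using E0_N[OF that] E0_v[OF that] J by auto
        then show ?thesis by simp
      qed
      moreover have "edge_wt \<tau> (card (e \<inter> insert v (\<omega> \<union> J)))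
          = edge_wt \<tau> (card (e \<inter> insert v (\<omega> \<union> (J \<inter> P k))))"
        if "k \<in> K" "e \<in> E k" for e k
      proof -
        have "e \<inter> insert v (\<omega> \<union> J) = e \<inter> insert v (\<omega> \<union> (J \<inter> P k))" using meet[OF that J] by auto
        then show ?thesis by simp
      qed
      ultimately show ?thesis
        unfolding wt_def split C_def g_def by (simp add: pow[OF J] prod.distrib mult_ac)
    qed
    have "exp (- s) * ((1 + s) * (\<Sum>J\<in>Pow (\<Union>k\<in>K. P k). \<Prod>k\<in>K. h k (J \<inter> P k))
      - 2 * (\<Sum>J\<in>Pow (\<Union>k\<in>K. P k). (\<Prod>k\<in>K. h k (J \<inter> P k)) * (\<Sum>k\<in>K. F k (J \<inter> P k))))
        \<le> (\<Sum>J\<in>Pow (\<Union>k\<in>K. P k). \<Prod>k\<in>K. g k (J \<inter> P k))"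
    proof (rule product_weight_tangent_bound)
      fix k assume k: "k \<in> K"
      then have kT: "k \<in> T" "v \<in> k" by (auto simp: K_def)
      obtain u w where P: "P k = {u, w}" and uw: "u \<noteq> w"
        using cardP[OF k] by (auto simp: card_2_iff)
      have "k = {v, u, w}" using P kT unfolding P_def by blast
      then have kE: "k \<in> E k" using kT P by (auto simp: E_def)
      have finE: "finite (E k)" using finite_T by (simp add: E_def)
      have kw: "k \<inter> \<omega> = {}" using \<omega> k by (auto simp: R_def N_def P_def)
      \<comment> \<open>The factor of the edges in \<open>E k\<close> other than \<open>k\<close>.
        By linearity they do not contain \<open>v\<close>, so \<open>h\<close> and \<open>g\<close>
        share it and differ only in the factor of \<open>k\<close> itself.\<close>
      define r where "r S = (\<Prod>e\<in>E k - {k}. edge_wt \<tau> (card (e \<inter> (\<omega> \<union> S))))" for S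
      have vE: "v \<notin> e" if "e \<in> E k - {k}" for e
        using that linear[of e k v] kT by (auto simp: E_def P_def)
      have h: "h k S = (1/8) ^ card S * (r S * edge_wt \<tau> (card S))" if "S \<subseteq> P k" for S
      proof -
        have "k \<inter> (\<omega> \<union> S) = S" using kw that by (auto simp: P_def)
        then show ?thesis
          unfolding h_def r_def by (subst prod.remove[OF finE kE]) simp
      qed
      have g: "g k S = (1/8) ^ card S * (r S * edge_wt \<tau> (Suc (card S)))" if S: "S \<subseteq> P k" for S
      proof -
        have "k \<inter> insert v (\<omega> \<union> S) = insert v S" using kw S kT by (auto simp: P_def)
        moreover have "card (insert v S) = Suc (card S)"
          using S finP[OF k] finite_subset by (subst card_insert_disjoint) (auto simp: P_def)
        moreover have "e \<inter> insert v (\<omega> \<union> S) = e \<inter> (\<omega> \<union> S)" if "e \<in> E k - {k}" for e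
          using vE[OF that] by auto
        ultimately show ?thesis
          unfolding g_def r_def by (subst prod.remove[OF finE kE]) simp
      qed
      \<comment> \<open>Every edge of \<open>E k\<close> has a vertex in \<open>N\<close>, which
        \<omega> avoids, so \<omega> cannot fill it.\<close>
      have r0: "0 < r {}" unfolding r_def
      proof (intro prod_pos edge_wt_pos)
        fix e assume e: "e \<in> E k - {k}"
        then have eT: "e \<in> T" by (auto simp: E_def)
        have "\<not> e \<subseteq> \<omega>" using e \<omega> k by (auto simp: E_def R_def N_def)
        then have "e \<inter> \<omega> \<subset> e" by auto
        then have "card (e \<inter> \<omega>) < card e" using eT finite_edge by (intro psubset_card_mono)
        then show "card (e \<inter> (\<omega> \<union> {})) \<le> 2" using edge_card[OF eT] by simp
      qed
      have rle: "r S \<le> r {}" "0 \<le> r S" for S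
        unfolding r_def using finite_edge
        by (auto intro!: prod_mono prod_nonneg edge_wt_nonneg edge_wt_antimono card_mono simp: E_def)
      have Pw: "Pow (P k) = {{}, {u}, {w}, {u, w}}" by (auto simp: P)
      have sum4: "(\<Sum>S\<in>Pow (P k). f S) = f {} + f {u} + f {w} + f {u, w}" for f :: "'a set \<Rightarrow> real"
        using uw by (simp add: Pw doubleton_eq_iff)
      define t where "t = (1 - \<tau>) * r {u, w}"
      have h4: "h k {} = r {}" "h k {u} = r {u} / 8" "h k {w} = r {w} / 8"
        "h k {u, w} = t / 64"
        using uw by (simp_all add: h P t_def power2_eq_square)
      have F4: "F k {} = 0" "F k {u} = \<tau>" "F k {w} = \<tau>" "F k {u, w} = 2 * \<tau> + 1"
        using uw by (simp_all add: F_def P doubleton_eq_iff)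
      have g4: "g k {} = r {}" "g k {u} = (1 - \<tau>) * r {u} / 8" "g k {w} = (1 - \<tau>) * r {w} / 8"
        "g k {u, w} = 0"
        using uw by (simp_all add: g P)
      have hs: "(\<Sum>S\<in>Pow (P k). h k S) = r {} + r {u} / 8 + r {w} / 8 + t / 64"
        unfolding sum4 h4 ..
      have hF: "(\<Sum>S\<in>Pow (P k). h k S * F k S)
          = (\<tau> * r {u}) / 8 + (\<tau> * r {w}) / 8 + (\<tau> * t) / 32 + t / 64"
        unfolding sum4 h4 F4 by (simp add: field_simps)
      have gs: "(\<Sum>S\<in>Pow (P k). g k S) = r {} + (1 - \<tau>) * r {u} / 8 + (1 - \<tau>) * r {w} / 8"
        unfolding sum4 g4 by simp
      have pos: "0 \<le> t" "0 \<le> \<tau> * r {u}" "0 \<le> \<tau> * r {w}"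
        using rle tau_nonneg tau_less by (simp_all add: t_def)
      have ub: "\<tau> * r {u} \<le> r {}" "\<tau> * r {w} \<le> r {}" "\<tau> * t \<le> t"
        "t \<le> r {}"
      proof -
        have *: "x * r S \<le> r {}" if "0 \<le> x" "x \<le> 1" for x S
          using rle[of S] mult_left_le_one_le[of "r S" x] that by linarith
        show "\<tau> * r {u} \<le> r {}" "\<tau> * r {w} \<le> r {}" "t \<le> r {}"
          unfolding t_def using tau_nonneg tau_less by (intro *; simp)+
        show "\<tau> * t \<le> t"
          using pos(1) tau_nonneg tau_less by (intro mult_left_le_one_le) auto
      qed
      show "0 < (\<Sum>S\<in>Pow (P k). h k S)" using r0 rle pos unfolding hs
        by (smt (verit) divide_nonneg_nonneg)
      have "0 \<le> \<tau> * t" using pos tau_nonneg by simp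
      then show "0 \<le> (\<Sum>S\<in>Pow (P k). h k S * F k S)" unfolding hF
        using pos by simp
      \<comment> \<open>The fugacity 1/8 is small enough here: the singly occupied states contribute
        at most \<open>r {} / 2\<close> on the left, and the doubly occupied state less than another
        half.\<close>
      show "2 * (\<Sum>S\<in>Pow (P k). h k S * F k S) \<le> (\<Sum>S\<in>Pow (P k). h k S)"
      proof -
        have "2 * (a / 8 + b / 8 + c / 32 + t / 64) \<le> r {} + x / 8 + y / 8 + t / 64"
          if "a \<le> r {}" "b \<le> r {}" "c \<le> t" "0 \<le> x" "0 \<le> y" for a b c x y
          using that ub(4) r0 by argo
        then show ?thesis
          unfolding hF hs using ub rle by blast
      qed
      \<comment> \<open>The costs \<tau> match the loss of the singly occupied states, and the
        summand 1 in \<open>F k (P k)\<close> removes the doubly occupied one. The two sides differ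
        by \<open>\<tau> * t / 32\<close>.\<close>
      show "(\<Sum>S\<in>Pow (P k). h k S) - (\<Sum>S\<in>Pow (P k). h k S * F k S) \<le> (\<Sum>S\<in>Pow (P k). g k S)"
        unfolding hF hs gs using \<open>0 \<le> \<tau> * t\<close> by (simp add: field_simps)
    qed (use finK finP disjP in auto)
    then have "C / 8 * (exp (- s) * ((1 + s) * (\<Sum>J\<in>Pow N. \<Prod>k\<in>K. h k (J \<inter> P k))
      - 2 * (\<Sum>J\<in>Pow N. (\<Prod>k\<in>K. h k (J \<inter> P k)) * (\<Sum>k\<in>K. F k (J \<inter> P k)))))
        \<le> C / 8 * (\<Sum>J\<in>Pow N. \<Prod>k\<in>K. g k (J \<inter> P k))"
      unfolding N_def using C by (intro mult_left_mono) auto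
    also have "\<dots> = (\<Sum>J\<in>Pow N. wt (insert v (\<omega> \<union> J)))"
      by (simp add: wt' sum_distrib_left)
    also have "C / 8 * (exp (- s) * ((1 + s) * (\<Sum>J\<in>Pow N. \<Prod>k\<in>K. h k (J \<inter> P k))
      - 2 * (\<Sum>J\<in>Pow N. (\<Prod>k\<in>K. h k (J \<inter> P k)) * (\<Sum>k\<in>K. F k (J \<inter> P k)))))
      = exp (- s) / 8 * ((1 + s) * (C * (\<Sum>J\<in>Pow N. \<Prod>k\<in>K. h k (J \<inter> P k)))
      - 2 * (C * (\<Sum>J\<in>Pow N. (\<Prod>k\<in>K. h k (J \<inter> P k)) * (\<Sum>k\<in>K. F k (J \<inter> P k)))))"
      by (simp add: algebra_simps)
    also have "C * (\<Sum>J\<in>Pow N. \<Prod>k\<in>K. h k (J \<inter> P k)) = (\<Sum>J\<in>Pow N. wt (\<omega> \<union> J))"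
      by (simp add: wt sum_distrib_left)
    also have "C * (\<Sum>J\<in>Pow N. (\<Prod>k\<in>K. h k (J \<inter> P k)) * (\<Sum>k\<in>K. F k (J \<inter> P k)))
        = (\<Sum>J\<in>Pow N. wt (\<omega> \<union> J) * cost v (\<omega> \<union> J))"
      using \<omega> by (simp add: wt cost sum_distrib_left mult.assoc)
    finally show ?thesis .
  qed
  \<comment> \<open>Both sides are linear in the weights, so the conditional estimates add up over
    \<omega>.\<close>
  have "exp (- s) / 8 * ((1 + s) * (\<Sum>I\<in>Pow (V - {v}). wt I)
      - 2 * (\<Sum>I\<in>Pow (V - {v}). wt I * cost v I))
    = (\<Sum>\<omega>\<in>Pow R. exp (- s) / 8 * ((1 + s) * (\<Sum>J\<in>Pow N. wt (\<omega> \<union> J))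
      - 2 * (\<Sum>J\<in>Pow N. wt (\<omega> \<union> J) * cost v (\<omega> \<union> J))))"
    unfolding RN(1) sum_Pow_Un[OF finR finN RN(2)]
    by (simp only: sum_subtractf flip: sum_distrib_left)
  also have "\<dots> \<le> (\<Sum>\<omega>\<in>Pow R. \<Sum>J\<in>Pow N. wt (insert v (\<omega> \<union> J)))"
    by (intro sum_mono inner) auto
  also have "\<dots> = (\<Sum>I\<in>Pow (V - {v}). wt (insert v I))"
    unfolding RN(1) sum_Pow_Un[OF finR finN RN(2)] ..
  finally show ?thesis .
qed

end

section \<open>The expected size of the random independent set\<close>

context weighted_3graph
begin

definition Z :: real where "Z = (\<Sum>I\<in>Pow V. wt I)"

text \<open>\<open>S / Z\<close> is the expected size of a random set drawn with probability
  proportional to \<open>wt\<close>.\<close>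

definition S :: real where "S = (\<Sum>I\<in>Pow V. wt I * card I)"

text \<open>For \<open>v\<close> in \<open>I\<close> this counts the edges at \<open>v\<close> that
  carry the penalty \<open>1 - \<tau>\<close>.\<close>

definition full_deg :: "'a \<Rightarrow> 'a set \<Rightarrow> nat" where
  "full_deg v I = card {e \<in> T. v \<in> e \<and> card (e \<inter> I) = 2}"

lemma Z_ge_1: "1 \<le> Z"
  using member_le_sum[of "{}" "Pow V" wt] finite_V wt_nonneg by (simp add: Z_def wt_empty)

text \<open>Each edge counted by \<open>full_deg\<close> had one occupied vertex before
  \<open>v\<close> was added and thus acquires the factor \<open>1 - \<tau>\<close>; no other factor
  increases.\<close>

lemma wt_insert_le_full_deg:
  assumes I: "I \<subseteq> V" "v \<notin> I"
  shows "wt (insert v I) \<le> (1/8) * (1 - \<tau>) ^ full_deg v (insert v I) * wt I"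
proof -
  have fin: "finite I" using I finite_V finite_subset by blast
  let ?J = "insert v I"
  let ?Q = "{e \<in> T. v \<in> e \<and> card (e \<inter> ?J) = 2}"
  have finQ: "finite ?Q" "?Q \<subseteq> T" using finite_T by auto
  have "(\<Prod>e\<in>?Q. edge_wt \<tau> (card (e \<inter> ?J))) = (\<Prod>e\<in>?Q. (1 - \<tau>) * edge_wt \<tau> (card (e \<inter> I)))"
  proof (intro prod.cong refl)
    fix e assume e: "e \<in> ?Q"
    then have "e \<inter> ?J = insert v (e \<inter> I)" by auto
    then have "card (e \<inter> ?J) = Suc (card (e \<inter> I))" using fin I(2) by simp
    moreover from this have "card (e \<inter> I) = 1" using e by simp
    ultimately show "edge_wt \<tau> (card (e \<inter> ?J)) = (1 - \<tau>) * edge_wt \<tau> (card (e \<inter> I))" by simp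
  qed
  then have Q: "(\<Prod>e\<in>?Q. edge_wt \<tau> (card (e \<inter> ?J)))
      = (1 - \<tau>) ^ full_deg v ?J * (\<Prod>e\<in>?Q. edge_wt \<tau> (card (e \<inter> I)))"
    by (simp add: prod.distrib full_deg_def)
  have rest: "(\<Prod>e\<in>T - ?Q. edge_wt \<tau> (card (e \<inter> ?J))) \<le> (\<Prod>e\<in>T - ?Q. edge_wt \<tau> (card (e \<inter> I)))"
    using fin finite_edge edge_wt_nonneg
    by (intro prod_mono conjI edge_wt_antimono card_mono) auto
  have "(\<Prod>e\<in>T. edge_wt \<tau> (card (e \<inter> ?J)))
      = (\<Prod>e\<in>T - ?Q. edge_wt \<tau> (card (e \<inter> ?J))) * (\<Prod>e\<in>?Q. edge_wt \<tau> (card (e \<inter> ?J)))"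
    using finQ finite_T by (intro prod.subset_diff) auto
  also have "\<dots> \<le> (\<Prod>e\<in>T - ?Q. edge_wt \<tau> (card (e \<inter> I)))
      * ((1 - \<tau>) ^ full_deg v ?J * (\<Prod>e\<in>?Q. edge_wt \<tau> (card (e \<inter> I))))"
    unfolding Q using rest tau_less
    by (intro mult_right_mono mult_nonneg_nonneg prod_nonneg edge_wt_nonneg) auto
  also have "\<dots> = (1 - \<tau>) ^ full_deg v ?J * (\<Prod>e\<in>T. edge_wt \<tau> (card (e \<inter> I)))"
    by (subst prod.subset_diff[OF finQ(2) finite_T]) simp
  finally show ?thesis
    using fin I(2) by (simp add: wt_def mult_left_mono mult_ac)
qed

lemma sum_Pow_split:
  "v \<in> V \<Longrightarrow> (\<Sum>I\<in>Pow V. f I) = (\<Sum>I\<in>Pow (V - {v}). f I) + (\<Sum>I\<in>Pow (V - {v}). f (insert v I))"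
  for f :: "'a set \<Rightarrow> real"
  using sum_Pow_insert[of "V - {v}" v f] finite_V by (simp add: insert_absorb)

text \<open>Occupying \<open>v\<close> never raises the weight, so \<open>v\<close> is free with
  probability at least 1/2.\<close>

lemma Z_le_twice:
  assumes "v \<in> V"
  shows "Z \<le> 2 * (\<Sum>I\<in>Pow (V - {v}). wt I)"
proof -
  have "(\<Sum>I\<in>Pow (V - {v}). wt (insert v I)) \<le> (\<Sum>I\<in>Pow (V - {v}). wt I)"
  proof (intro sum_mono)
    fix I assume "I \<in> Pow (V - {v})"
    then show "wt (insert v I) \<le> wt I"
      using wt_insert_le[of I v] wt_nonneg[of I] by fastforce
  qed
  then show ?thesis
    unfolding Z_def sum_Pow_split[OF assms] by simp
qed

text \<open>Double counting of pairs of a set and one of its elements, where the set is encoded by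
  what remains after removing that element.\<close>

lemma sum_mem_wt: "(\<Sum>v\<in>V. \<Sum>I\<in>Pow (V - {v}). wt (insert v I) * f v (insert v I))
    = (\<Sum>I\<in>Pow V. wt I * (\<Sum>v\<in>I. f v I))"
proof -
  have "(\<Sum>I\<in>Pow (V - {v}). wt (insert v I) * f v (insert v I))
      = (\<Sum>I\<in>Pow V. if v \<in> I then wt I * f v I else 0)" if "v \<in> V" for v
  proof -
    have "(\<Sum>I\<in>Pow (V - {v}). if v \<in> I then wt I * f v I else 0) = 0"
      by (intro sum.neutral) auto
    then show ?thesis unfolding sum_Pow_split[OF that] by simp
  qed
  then have "(\<Sum>v\<in>V. \<Sum>I\<in>Pow (V - {v}). wt (insert v I) * f v (insert v I))
      = (\<Sum>v\<in>V. \<Sum>I\<in>Pow V. if v \<in> I then wt I * f v I else 0)"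
    by simp
  also have "\<dots> = (\<Sum>I\<in>Pow V. \<Sum>v\<in>V. if v \<in> I then wt I * f v I else 0)"
    by (rule sum.swap)
  also have "\<dots> = (\<Sum>I\<in>Pow V. wt I * (\<Sum>v\<in>I. f v I))"
  proof (intro sum.cong refl)
    fix I assume "I \<in> Pow V"
    then have "V \<inter> I = I" by auto
    then show "(\<Sum>v\<in>V. if v \<in> I then wt I * f v I else 0) = wt I * (\<Sum>v\<in>I. f v I)"
      using finite_V sum.inter_restrict[of V "\<lambda>v. wt I * f v I" I] by (simp add: sum_distrib_left)
  qed
  finally show ?thesis .
qed

lemma S_alt: "(\<Sum>v\<in>V. \<Sum>I\<in>Pow (V - {v}). wt (insert v I)) = S"
  using sum_mem_wt[of "\<lambda>_ _. 1"] by (simp add: S_def)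

text \<open>A vertex of large \<^const>\<open>full_deg\<close> is exponentially unlikely because of the factors
  \<open>1 - \<tau>\<close>; this replaces the missing correlation bound for pairs of occupied vertices.\<close>

lemma sum_full_deg_le:
  assumes d: "0 \<le> d" and D: "0 \<le> D"
  shows "(\<Sum>I\<in>Pow V. wt I * (\<Sum>v\<in>I. real (full_deg v I)))
    \<le> D * S + card V * (d * exp (- \<tau> * D) / 8 * Z)"
proof -
  have "wt (insert v I) * full_deg v (insert v I) \<le> D * wt (insert v I) + d * exp (- \<tau> * D) / 8 * wt I"
    if v: "v \<in> V" and I: "I \<in> Pow (V - {v})" for v I
  proof (cases "full_deg v (insert v I) \<le> D")
    case True
    then have "wt (insert v I) * full_deg v (insert v I) \<le> wt (insert v I) * D"
      using wt_nonneg by (intro mult_left_mono)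
    then show ?thesis
      using d wt_nonneg[of I] by (simp add: mult.commute add_increasing2)
  next
    case False
    let ?q = "full_deg v (insert v I)"
    have "1 - \<tau> \<le> exp (- \<tau>)" using exp_ge_add_one_self[of "- \<tau>"] by simp
    then have "(1 - \<tau>) ^ ?q \<le> exp (- \<tau>) ^ ?q" using tau_less by (intro power_mono) auto
    also have "\<dots> = exp (- \<tau> * ?q)" by (simp add: exp_of_nat_mult[symmetric] mult.commute)
    also have "\<dots> \<le> exp (- \<tau> * D)" using False tau_nonneg by (simp add: mult_left_mono)
    finally have 1: "(1 - \<tau>) ^ ?q \<le> exp (- \<tau> * D)" .
    have "?q \<le> card {e \<in> T. v \<in> e}"
      unfolding full_deg_def using finite_T by (intro card_mono) auto
    then have 2: "real ?q \<le> d" using degree_le[OF v] by linarith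
    have "wt (insert v I) * ?q \<le> ((1/8) * (1 - \<tau>) ^ ?q * wt I) * d"
      using I wt_insert_le_full_deg[of I v] 2 wt_nonneg
      by (intro mult_mono mult_nonneg_nonneg) (use tau_less in auto)
    also have "\<dots> \<le> ((1/8) * exp (- \<tau> * D) * wt I) * d"
      using 1 wt_nonneg d by (intro mult_right_mono mult_left_mono) auto
    finally show ?thesis
      using D wt_nonneg[of "insert v I"] by (simp add: mult_ac add_increasing)
  qed
  then have "(\<Sum>v\<in>V. \<Sum>I\<in>Pow (V - {v}). wt (insert v I) * full_deg v (insert v I))
      \<le> (\<Sum>v\<in>V. \<Sum>I\<in>Pow (V - {v}). D * wt (insert v I) + d * exp (- \<tau> * D) / 8 * wt I)"
    by (intro sum_mono)
  also have "\<dots> = D * S + (\<Sum>v\<in>V. d * exp (- \<tau> * D) / 8 * (\<Sum>I\<in>Pow (V - {v}). wt I))"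
    by (simp add: sum.distrib S_alt[symmetric] sum_distrib_left)
  also have "\<dots> \<le> D * S + (\<Sum>v\<in>V. d * exp (- \<tau> * D) / 8 * Z)"
    unfolding Z_def using d finite_V wt_nonneg
    by (intro add_left_mono sum_mono mult_left_mono sum_mono2) auto
  finally show ?thesis
    by (simp add: sum_mem_wt[of "\<lambda>v I. real (full_deg v I)"])
qed

lemma sum_incident_eq:
  fixes f :: "'a \<Rightarrow> 'a set \<Rightarrow> real"
  assumes "A \<subseteq> V"
  shows "(\<Sum>v\<in>A. \<Sum>e | e \<in> T \<and> v \<in> e. f v e) = (\<Sum>e\<in>T. \<Sum>v\<in>e \<inter> A. f v e)"
proof -
  have finA: "finite A" using assms finite_V finite_subset by blast
  have "(\<Sum>v\<in>A. \<Sum>e | e \<in> T \<and> v \<in> e. f v e) = (\<Sum>v\<in>A. \<Sum>e\<in>T. if v \<in> e then f v e else 0)"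
    using finite_T by (simp add: sum.inter_filter)
  also have "\<dots> = (\<Sum>e\<in>T. \<Sum>v\<in>A. if v \<in> e then f v e else 0)"
    by (rule sum.swap)
  also have "\<dots> = (\<Sum>e\<in>T. \<Sum>v\<in>A \<inter> e. f v e)"
    using finA by (simp add: sum.inter_restrict)
  finally show ?thesis by (simp add: Int_commute)
qed

text \<open>For the \<tau>-part, an edge has at most three vertices outside \<open>I\<close>, and a
  vertex of \<open>I\<close> lies in at most \<open>d\<close> edges. For the blocking part, an edge
  with exactly one vertex outside \<open>I\<close> contributes 1 on the left, and each of its two
  occupied vertices counts it in \<open>full_deg\<close>.\<close>

lemma sum_cost_le:
  assumes I: "I \<subseteq> V"
  shows "(\<Sum>v\<in>V - I. cost v I) \<le> 3 * \<tau> * d * card I + (\<Sum>v\<in>I. real (full_deg v I))"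
proof -
  have "(\<Sum>v\<in>V - I. cost v I)
      = (\<Sum>e\<in>T. \<Sum>v\<in>e \<inter> (V - I). \<tau> * card (e \<inter> I) + (if e - {v} \<subseteq> I then 1 else 0))"
    unfolding cost_def by (intro sum_incident_eq) auto
  also have "\<dots> \<le> (\<Sum>e\<in>T. 3 * \<tau> * card (e \<inter> I) + (\<Sum>v\<in>e \<inter> I. if card (e \<inter> I) = 2 then 1 else 0))"
  proof (intro sum_mono)
    fix e assume e: "e \<in> T"
    have fe: "finite e" using e finite_edge by blast
    have "card (e \<inter> (V - I)) \<le> 3"
      using card_mono[OF fe, of "e \<inter> (V - I)"] edge_card[OF e] by auto
    then have "real (card (e \<inter> (V - I))) * (\<tau> * card (e \<inter> I)) \<le> 3 * (\<tau> * card (e \<inter> I))"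
      using tau_nonneg by (intro mult_right_mono) auto
    then have 1: "(\<Sum>v\<in>e \<inter> (V - I). \<tau> * card (e \<inter> I)) \<le> 3 * \<tau> * card (e \<inter> I)"
      by simp
    have 2: "(\<Sum>v\<in>e \<inter> (V - I). if e - {v} \<subseteq> I then 1 else 0 :: real)
        \<le> (\<Sum>v\<in>e \<inter> I. if card (e \<inter> I) = 2 then 1 else 0)"
    proof (cases "\<exists>v\<in>e - I. e - {v} \<subseteq> I")
      case True
      then obtain v where v: "v \<in> e" "v \<notin> I" "e - {v} \<subseteq> I" by auto
      then have eq: "e \<inter> I = e - {v}" by auto
      then have "card (e \<inter> I) = 2" using v fe edge_card[OF e] by simp
      moreover have "e \<inter> (V - I) \<subseteq> {v}" using v by auto
      then have "(\<Sum>v\<in>e \<inter> (V - I). if e - {v} \<subseteq> I then 1 else 0 :: real)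
          \<le> (\<Sum>v\<in>{v}. if e - {v} \<subseteq> I then 1 else 0)"
        by (intro sum_mono2) auto
      then have "(\<Sum>v\<in>e \<inter> (V - I). if e - {v} \<subseteq> I then 1 else 0 :: real) \<le> 1"
        by (rule order_trans) simp
      ultimately show ?thesis by simp
    next
      case False
      then have "(\<Sum>v\<in>e \<inter> (V - I). if e - {v} \<subseteq> I then 1 else 0 :: real) = 0"
        by (intro sum.neutral) auto
      then show ?thesis by (simp add: sum_nonneg)
    qed
    show "(\<Sum>v\<in>e \<inter> (V - I). \<tau> * card (e \<inter> I) + (if e - {v} \<subseteq> I then 1 else 0))
        \<le> 3 * \<tau> * card (e \<inter> I) + (\<Sum>v\<in>e \<inter> I. if card (e \<inter> I) = 2 then 1 else 0)"
      unfolding sum.distrib using 1 2 by linarith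
  qed
  also have "\<dots> = 3 * \<tau> * (\<Sum>e\<in>T. \<Sum>v\<in>e \<inter> I. 1)
      + (\<Sum>e\<in>T. \<Sum>v\<in>e \<inter> I. if card (e \<inter> I) = 2 then 1 else 0)"
    by (simp add: sum.distrib sum_distrib_left)
  also have "(\<Sum>e\<in>T. \<Sum>v\<in>e \<inter> I. 1) = (\<Sum>v\<in>I. real (card {e \<in> T. v \<in> e}))"
    using sum_incident_eq[OF I, of "\<lambda>_ _. 1"] by simp
  also have "(\<Sum>e\<in>T. \<Sum>v\<in>e \<inter> I. if card (e \<inter> I) = 2 then 1 else 0) = (\<Sum>v\<in>I. real (full_deg v I))"
  proof -
    have "(\<Sum>e | e \<in> T \<and> v \<in> e. if card (e \<inter> I) = 2 then 1 else 0 :: real)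
        = (\<Sum>e | e \<in> {e \<in> T. v \<in> e} \<and> card (e \<inter> I) = 2. 1)" for v
      using finite_T by (intro sum.inter_filter[symmetric]) auto
    then have "(\<Sum>e | e \<in> T \<and> v \<in> e. if card (e \<inter> I) = 2 then 1 else 0 :: real) = full_deg v I" for v
      by (simp add: full_deg_def conj_assoc)
    then show ?thesis
      using sum_incident_eq[OF I, of "\<lambda>_ e. if card (e \<inter> I) = 2 then 1 else 0"] by simp
  qed
  also have "3 * \<tau> * (\<Sum>v\<in>I. real (card {e \<in> T. v \<in> e})) \<le> 3 * \<tau> * (\<Sum>v\<in>I. d)"
    using I tau_nonneg degree_le by (intro mult_left_mono sum_mono) auto
  finally show ?thesis by (simp add: mult_ac)
qed

text \<open>The local estimates summed over all \<open>v\<close>, with \<open>Z_le_twice\<close> for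
  the main term and the two preceding bounds for the cost. As \<open>S\<close> also enters the left
  side negatively, a small \<open>S\<close> makes its own lower bound large.\<close>

lemma occupied_ge:
  fixes s D :: real
  assumes s: "0 \<le> s" and d: "0 \<le> d" and D: "0 \<le> D"
  shows "exp (- s) / 8 * ((1 + s) * card V * Z / 2
    - 2 * ((3 * \<tau> * d + D) * S + card V * (d * exp (- \<tau> * D) / 8 * Z))) \<le> S"
proof -
  have swap: "(\<Sum>v\<in>V. \<Sum>I\<in>Pow (V - {v}). wt I * cost v I) = (\<Sum>I\<in>Pow V. wt I * (\<Sum>v\<in>V - I. cost v I))"
  proof -
    have "(\<Sum>v\<in>V. \<Sum>I\<in>Pow (V - {v}). wt I * cost v I)
        = (\<Sum>v\<in>V. \<Sum>I\<in>Pow V. if v \<notin> I then wt I * cost v I else 0)"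
    proof (rule sum.cong[OF refl])
      fix v assume "v \<in> V"
      have "Pow (V - {v}) = {I \<in> Pow V. v \<notin> I}" by auto
      then show "(\<Sum>I\<in>Pow (V - {v}). wt I * cost v I)
          = (\<Sum>I\<in>Pow V. if v \<notin> I then wt I * cost v I else 0)"
        using finite_V by (simp only: sum.inter_filter finite_Pow_iff)
    qed
    also have "\<dots> = (\<Sum>I\<in>Pow V. \<Sum>v\<in>V. if v \<notin> I then wt I * cost v I else 0)"
      by (rule sum.swap)
    also have "\<dots> = (\<Sum>I\<in>Pow V. wt I * (\<Sum>v\<in>V - I. cost v I))"
    proof (intro sum.cong refl)
      fix I
      have "V - I = {v \<in> V. v \<notin> I}" by auto
      then show "(\<Sum>v\<in>V. if v \<notin> I then wt I * cost v I else 0) = wt I * (\<Sum>v\<in>V - I. cost v I)"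
        unfolding sum_distrib_left using finite_V by (simp only: sum.inter_filter)
    qed
    finally show ?thesis .
  qed
  have M: "(\<Sum>v\<in>V. \<Sum>I\<in>Pow (V - {v}). wt I * cost v I)
      \<le> (3 * \<tau> * d + D) * S + card V * (d * exp (- \<tau> * D) / 8 * Z)"
  proof -
    have "(\<Sum>I\<in>Pow V. wt I * (\<Sum>v\<in>V - I. cost v I))
        \<le> (\<Sum>I\<in>Pow V. wt I * (3 * \<tau> * d * card I + (\<Sum>v\<in>I. real (full_deg v I))))"
      using wt_nonneg by (intro sum_mono mult_left_mono sum_cost_le) auto
    also have "\<dots> = 3 * \<tau> * d * S + (\<Sum>I\<in>Pow V. wt I * (\<Sum>v\<in>I. real (full_deg v I)))"
      by (simp add: S_def algebra_simps sum.distrib sum_distrib_left)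
    also have "\<dots> \<le> 3 * \<tau> * d * S + (D * S + card V * (d * exp (- \<tau> * D) / 8 * Z))"
      using sum_full_deg_le[OF d D] by simp
    finally show ?thesis unfolding swap by (simp add: algebra_simps)
  qed
  have W: "card V * Z / 2 \<le> (\<Sum>v\<in>V. \<Sum>I\<in>Pow (V - {v}). wt I)"
  proof -
    have "(\<Sum>v\<in>V. Z / 2) \<le> (\<Sum>v\<in>V. \<Sum>I\<in>Pow (V - {v}). wt I)"
      using Z_le_twice by (intro sum_mono) fastforce
    then show ?thesis by simp
  qed
  have "(1 + s) * card V * Z / 2 - 2 * ((3 * \<tau> * d + D) * S + card V * (d * exp (- \<tau> * D) / 8 * Z))
      \<le> (1 + s) * (\<Sum>v\<in>V. \<Sum>I\<in>Pow (V - {v}). wt I)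
        - 2 * (\<Sum>v\<in>V. \<Sum>I\<in>Pow (V - {v}). wt I * cost v I)"
  proof -
    have "(1 + s) * card V * Z / 2 = (1 + s) * (card V * Z / 2)" by simp
    also have "\<dots> \<le> (1 + s) * (\<Sum>v\<in>V. \<Sum>I\<in>Pow (V - {v}). wt I)"
      using s by (intro mult_left_mono W) auto
    finally show ?thesis by (intro diff_mono mult_left_mono M) auto
  qed
  then have "exp (- s) / 8 * ((1 + s) * card V * Z / 2
      - 2 * ((3 * \<tau> * d + D) * S + card V * (d * exp (- \<tau> * D) / 8 * Z)))
    \<le> exp (- s) / 8 * ((1 + s) * (\<Sum>v\<in>V. \<Sum>I\<in>Pow (V - {v}). wt I)
        - 2 * (\<Sum>v\<in>V. \<Sum>I\<in>Pow (V - {v}). wt I * cost v I))"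
    by (intro mult_left_mono) auto
  also have "\<dots> = (\<Sum>v\<in>V. exp (- s) / 8 * ((1 + s) * (\<Sum>I\<in>Pow (V - {v}). wt I)
      - 2 * (\<Sum>I\<in>Pow (V - {v}). wt I * cost v I)))"
    by (simp only: sum_subtractf flip: sum_distrib_left)
  also have "\<dots> \<le> (\<Sum>v\<in>V. \<Sum>I\<in>Pow (V - {v}). wt (insert v I))"
    by (intro sum_mono sum_wt_insert_ge)
  finally show ?thesis by (simp add: S_alt)
qed

text \<open>Some set of nonzero weight is at least as large as the average, and a set containing an
  edge has weight 0 because \<open>edge_wt\<close> vanishes at 3.\<close>

lemma exists_independent_ge:
  assumes "a * Z \<le> S"
  obtains I where "I \<subseteq> V" "\<And>e. e \<in> T \<Longrightarrow> \<not> e \<subseteq> I" "a \<le> card I"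
proof -
  have "\<exists>I\<in>Pow V. wt I \<noteq> 0 \<and> a \<le> card I"
  proof (rule ccontr)
    assume *: "\<not> ?thesis"
    have "wt I * card I \<le> wt I * a" if "I \<in> Pow V" for I
      using * that wt_nonneg[of I] by (cases "wt I = 0") (auto intro!: mult_left_mono simp: not_le less_imp_le)
    \<comment> \<open>The empty set has weight 1 and supplies the strict inequality.\<close>
    moreover have "wt {} * card {} < wt {} * a"
      using * by (force simp: wt_empty)
    ultimately have "S < (\<Sum>I\<in>Pow V. wt I * a)"
      unfolding S_def using finite_V by (intro sum_strict_mono_ex1) (auto intro!: bexI[of _ "{}"])
    then show False using assms by (simp add: Z_def sum_distrib_left mult.commute)
  qed
  then obtain I where I: "I \<subseteq> V" "wt I \<noteq> 0" "a \<le> card I" by auto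
  have "\<not> e \<subseteq> I" if "e \<in> T" for e
  proof
    assume "e \<subseteq> I"
    then have "card (e \<inter> I) = 3" using edge_card[OF that] by (simp add: Int_absorb2)
    then have "edge_wt \<tau> (card (e \<inter> I)) = 0" by (simp add: edge_wt_def)
    then show False using I(2) that finite_T by (auto simp: wt_def)
  qed
  with I that show ?thesis by blast
qed

end

text \<open>If the density were below \<open>\<tau> / 64\<close>, the expected cost would be so
  small that \<open>occupied_ge\<close> forces a density of at least
  \<open>exp (- ln d / 4) / 32\<close>, a contradiction because \<open>d powr (-1/4)\<close>
  dominates \<open>sqrt (ln d / d)\<close>.\<close>

lemma (in sparse_3graph) exists_independent:
  assumes d: "1 \<le> d"
  obtains I where "I \<subseteq> V" "\<And>e. e \<in> T \<Longrightarrow> \<not> e \<subseteq> I" "sqrt (ln d / d) / 64 * card V \<le> card I"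
proof -
  define L where "L = ln d"
  define \<tau> where "\<tau> = sqrt (L / d)"
  have L: "0 \<le> L" "L < d" using d ln_less_self[of d] by (auto simp: L_def)
  have \<tau>: "0 \<le> \<tau>" "\<tau> < 1" using L d by (simp_all add: \<tau>_def)
  interpret weighted_3graph V T d \<tau>
    by unfold_locales (use \<tau> in auto)
  have \<tau>d: "\<tau> * (\<tau> * d) = L"
  proof -
    have "\<tau> * (\<tau> * d) = \<tau>\<^sup>2 * d" by (simp add: power2_eq_square)
    also have "\<dots> = L" using L d by (simp add: \<tau>_def)
    finally show ?thesis .
  qed
  have "\<tau> / 64 * card V * Z \<le> S"
  proof (rule ccontr)
    assume "\<not> ?thesis"
    then have S: "S < \<tau> / 64 * card V * Z" by simp
    define n where "n = card V * Z"
    have n: "0 \<le> n" using Z_ge_1 by (simp add: n_def)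
    have dS: "\<tau> * d * S \<le> L * n / 64"
    proof -
      have "\<tau> * d * S \<le> \<tau> * d * (\<tau> / 64 * card V * Z)"
        using S d \<tau> by (intro mult_left_mono) auto
      also have "\<dots> = \<tau> * (\<tau> * d) * n / 64" by (simp add: n_def mult_ac)
      finally show ?thesis by (simp add: \<tau>d)
    qed
    have "exp (- (\<tau> * (\<tau> * d))) = 1 / d"
      using d by (simp add: \<tau>d L_def exp_minus inverse_eq_divide)
    then have ed: "d * exp (- \<tau> * (\<tau> * d)) = 1" using d by simp
    \<comment> \<open>With \<open>s = L / 4\<close> the tangent gains \<open>L * n / 8\<close>,
      which pays for \<open>8 * (\<tau> * d * S)\<close> by \<open>dS\<close>. With
      \<open>D = \<tau> * d\<close> one has \<open>\<tau> * D = ln d\<close>, so the tail term is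
      only \<open>n / 4\<close>.\<close>
    have "exp (- (L / 4)) / 8 * ((1 + L / 4) * card V * Z / 2
        - 2 * ((3 * \<tau> * d + \<tau> * d) * S + card V * (d * exp (- \<tau> * (\<tau> * d)) / 8 * Z))) \<le> S"
      using occupied_ge[of "L / 4" "\<tau> * d"] L d \<tau> by simp
    also have "(1 + L / 4) * card V * Z / 2
        - 2 * ((3 * \<tau> * d + \<tau> * d) * S + card V * (d * exp (- \<tau> * (\<tau> * d)) / 8 * Z))
      = (1 + L / 4) * n / 2 - 8 * (\<tau> * d * S) - n / 4"
      unfolding ed by (simp add: n_def algebra_simps)
    finally have "exp (- (L / 4)) / 8 * ((1 + L / 4) * n / 2 - 8 * (\<tau> * d * S) - n / 4) \<le> S" .
    moreover have "n / 4 \<le> (1 + L / 4) * n / 2 - 8 * (\<tau> * d * S) - n / 4"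
      using dS by (simp add: algebra_simps)
    then have "exp (- (L / 4)) / 8 * (n / 4)
        \<le> exp (- (L / 4)) / 8 * ((1 + L / 4) * n / 2 - 8 * (\<tau> * d * S) - n / 4)"
      by (intro mult_left_mono) auto
    moreover have "S < \<tau> / 64 * n" using S by (simp add: n_def mult.assoc)
    ultimately have "exp (- (L / 4)) / 8 * (n / 4) < \<tau> / 64 * n" by linarith
    then have "exp (- (L / 4)) / 32 * n < \<tau> / 64 * n" by simp
    then have "(2 * exp (- (L / 4))) * n < \<tau> * n" by (simp add: mult_ac)
    then have "2 * exp (- (L / 4)) < \<tau>"
      using n by (rule mult_right_less_imp_less)
    \<comment> \<open>Squaring and clearing exponentials yields \<open>4 * sqrt d < ln d\<close>,
      which is impossible.\<close>
    then have "(2 * exp (- (L / 4)))\<^sup>2 < \<tau>\<^sup>2"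
      by (intro power_strict_mono) auto
    moreover have "(2 * exp (- (L / 4)))\<^sup>2 = 4 * exp (- (L / 2))"
      by (simp add: power_mult_distrib flip: exp_of_nat_mult exp_double)
    moreover have "\<tau>\<^sup>2 = L * exp (- L)"
      using L d by (simp add: \<tau>_def L_def exp_minus inverse_eq_divide)
    ultimately have "4 * exp (- (L / 2)) * exp L < L * exp (- L) * exp L"
      by (intro mult_strict_right_mono) auto
    then have "4 * exp (L / 2) < L" by (simp flip: exp_add add: mult.assoc)
    moreover have "1 + L / 2 \<le> exp (L / 2)" by (rule exp_ge_add_one_self)
    ultimately show False using L by linarith
  qed
  then obtain I where "I \<subseteq> V" "\<And>e. e \<in> T \<Longrightarrow> \<not> e \<subseteq> I" "\<tau> / 64 * card V \<le> card I"
    using exists_independent_ge[of "\<tau> / 64 * card V"] by blast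
  then show ?thesis using that by (simp add: \<tau>_def L_def)
qed

section \<open>Families of sets without triples\<close>

text \<open>The probability that a random subset contains \<open>F\<close>: giving the elements of
  \<open>F\<close> the factor 0 when omitted encodes the event, and the sum is an expanded
  product.\<close>

lemma sum_bernoulli_superset:
  fixes q :: real
  assumes U: "finite U" and F: "F \<subseteq> U"
  shows "(\<Sum>V\<in>Pow U. q ^ card V * (1 - q) ^ card (U - V) * (if F \<subseteq> V then 1 else 0)) = q ^ card F"
proof -
  have "q ^ card V * (1 - q) ^ card (U - V) * (if F \<subseteq> V then 1 else 0)
      = (\<Prod>x\<in>V. q) * (\<Prod>x\<in>U - V. if x \<in> F then 0 else 1 - q)" if "V \<in> Pow U" for V
  proof (cases "F \<subseteq> V")
    case True
    then have "(\<Prod>x\<in>U - V. if x \<in> F then 0 else 1 - q) = (\<Prod>x\<in>U - V. 1 - q)"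
      by (intro prod.cong) auto
    with True show ?thesis by simp
  next
    case False
    then have "(\<Prod>x\<in>U - V. if x \<in> F then 0 else 1 - q) = 0"
      using F U by (auto simp: prod_zero_iff)
    with False show ?thesis by simp
  qed
  then have "(\<Sum>V\<in>Pow U. q ^ card V * (1 - q) ^ card (U - V) * (if F \<subseteq> V then 1 else 0))
      = (\<Sum>V\<in>Pow U. (\<Prod>x\<in>V. q) * (\<Prod>x\<in>U - V. if x \<in> F then 0 else 1 - q))"
    by (rule sum.cong[OF refl])
  also have "\<dots> = (\<Prod>x\<in>U. q + (if x \<in> F then 0 else 1 - q))"
    using U by (rule prod_add[symmetric])
  also have "\<dots> = (\<Prod>x\<in>U. if x \<in> F then q else 1)"
    by (intro prod.cong) auto
  also have "\<dots> = (\<Prod>x\<in>U \<inter> F. q)"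
    using U by (rule prod.inter_restrict[symmetric])
  finally show ?thesis
    using F by (simp add: Int_absorb1)
qed

text \<open>The deletion method. A selected vertex scores 1, minus 1 for every bad configuration
  present and \<open>1 / d\<close> for every link present. The mean score is at least
  \<open>q * card U * (1 - 1/2 - 1/4)\<close>, and a vertex that is not good scores at most 0, so
  some \<open>V\<close> has that many good vertices.\<close>

lemma random_sparsification:
  fixes q d :: real
  assumes U: "finite U" and q: "0 \<le> q" "q \<le> 1" and d: "0 < d"
    and bad: "\<And>A. A \<in> U \<Longrightarrow> finite (bad A)" "\<And>A B. A \<in> U \<Longrightarrow> B \<in> bad A \<Longrightarrow> B \<subseteq> U - {A}"
    and link: "\<And>A. A \<in> U \<Longrightarrow> finite (link A)" "\<And>A B. A \<in> U \<Longrightarrow> B \<in> link A \<Longrightarrow> B \<subseteq> U - {A}"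
    and bad_sum: "\<And>A. A \<in> U \<Longrightarrow> (\<Sum>B\<in>bad A. q ^ card B) \<le> 1/2"
    and link_sum: "\<And>A. A \<in> U \<Longrightarrow> (\<Sum>B\<in>link A. q ^ card B) \<le> d / 4"
  obtains V where "V \<subseteq> U"
    "q * card U / 4 \<le> card {A \<in> V. (\<forall>B\<in>bad A. \<not> B \<subseteq> V) \<and> card {B \<in> link A. B \<subseteq> V} \<le> d}"
proof -
  define \<mu> where "\<mu> V = q ^ card V * (1 - q) ^ card (U - V)" for V
  define ind where "ind F V = (if F \<subseteq> V then 1 else 0 :: real)" for F V :: "'a set"
  define score where "score V = (\<Sum>A\<in>U. ind {A} V - (\<Sum>B\<in>bad A. ind (insert A B) V)
      - (\<Sum>B\<in>link A. ind (insert A B) V) / d)" for V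
  have \<mu>: "0 \<le> \<mu> V" for V using q by (simp add: \<mu>_def)
  have E: "(\<Sum>V\<in>Pow U. \<mu> V * ind F V) = q ^ card F" if "F \<subseteq> U" for F
    using sum_bernoulli_superset[OF U that] by (simp add: \<mu>_def ind_def)
  have E_ins: "(\<Sum>V\<in>Pow U. \<mu> V * ind (insert A B) V) = q * q ^ card B"
    if "A \<in> U" "B \<subseteq> U - {A}" for A B
  proof -
    have "finite B" "A \<notin> B" using that U finite_subset by auto
    then show ?thesis using E[of "insert A B"] that by auto
  qed
  have E_sum: "(\<Sum>V\<in>Pow U. \<mu> V * (\<Sum>B\<in>\<B>. ind (insert A B) V)) = q * (\<Sum>B\<in>\<B>. q ^ card B)"
    if "A \<in> U" "\<And>B. B \<in> \<B> \<Longrightarrow> B \<subseteq> U - {A}" for A \<B>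
  proof -
    have "(\<Sum>V\<in>Pow U. \<mu> V * (\<Sum>B\<in>\<B>. ind (insert A B) V))
        = (\<Sum>B\<in>\<B>. \<Sum>V\<in>Pow U. \<mu> V * ind (insert A B) V)"
      unfolding sum_distrib_left by (rule sum.swap)
    also have "\<dots> = (\<Sum>B\<in>\<B>. q * q ^ card B)"
      using that by (intro sum.cong refl E_ins) auto
    finally show ?thesis by (simp add: sum_distrib_left)
  qed
  have "(\<Sum>V\<in>Pow U. \<mu> V * score V) = (\<Sum>A\<in>U. \<Sum>V\<in>Pow U. \<mu> V *
      (ind {A} V - (\<Sum>B\<in>bad A. ind (insert A B) V) - (\<Sum>B\<in>link A. ind (insert A B) V) / d))"
    unfolding score_def sum_distrib_left by (rule sum.swap)
  also have "\<dots> = (\<Sum>A\<in>U. q - q * (\<Sum>B\<in>bad A. q ^ card B) - q * (\<Sum>B\<in>link A. q ^ card B) / d)"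
  proof (intro sum.cong refl)
    fix A assume A: "A \<in> U"
    have "(\<Sum>V\<in>Pow U. \<mu> V *
        (ind {A} V - (\<Sum>B\<in>bad A. ind (insert A B) V) - (\<Sum>B\<in>link A. ind (insert A B) V) / d))
      = (\<Sum>V\<in>Pow U. \<mu> V * ind {A} V) - (\<Sum>V\<in>Pow U. \<mu> V * (\<Sum>B\<in>bad A. ind (insert A B) V))
        - (\<Sum>V\<in>Pow U. \<mu> V * (\<Sum>B\<in>link A. ind (insert A B) V)) / d"
      by (simp add: right_diff_distrib sum_subtractf flip: sum_divide_distrib)
    also have "\<dots> = q - q * (\<Sum>B\<in>bad A. q ^ card B) - q * (\<Sum>B\<in>link A. q ^ card B) / d"
      using E[of "{A}"] E_sum[OF A bad(2)[OF A]] E_sum[OF A link(2)[OF A]] A by simp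
    finally show "(\<Sum>V\<in>Pow U. \<mu> V *
        (ind {A} V - (\<Sum>B\<in>bad A. ind (insert A B) V) - (\<Sum>B\<in>link A. ind (insert A B) V) / d))
      = q - q * (\<Sum>B\<in>bad A. q ^ card B) - q * (\<Sum>B\<in>link A. q ^ card B) / d" .
  qed
  also have "\<dots> \<ge> (\<Sum>A\<in>U. q / 4)"
  proof (intro sum_mono)
    fix A assume A: "A \<in> U"
    have "q * (\<Sum>B\<in>bad A. q ^ card B) \<le> q * (1/2)"
      using bad_sum[OF A] q by (intro mult_left_mono)
    moreover have "q * (\<Sum>B\<in>link A. q ^ card B) \<le> q * (d / 4)"
      using link_sum[OF A] q by (intro mult_left_mono)
    then have "q * (\<Sum>B\<in>link A. q ^ card B) / d \<le> q / 4"
      using d by (simp add: field_simps)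
    ultimately show "q / 4 \<le> q - q * (\<Sum>B\<in>bad A. q ^ card B) - q * (\<Sum>B\<in>link A. q ^ card B) / d"
      by linarith
  qed
  finally have mean: "q * card U / 4 \<le> (\<Sum>V\<in>Pow U. \<mu> V * score V)"
    by (simp add: mult.commute)
  have total: "(\<Sum>V\<in>Pow U. \<mu> V) = 1"
    using E[of "{}"] by (simp add: ind_def)
  have "\<exists>V\<in>Pow U. q * card U / 4 \<le> score V"
  proof (rule ccontr)
    assume "\<not> ?thesis"
    then have lt: "score V < q * card U / 4" if "V \<in> Pow U" for V using that by (auto simp: not_le)
    obtain V where V: "V \<in> Pow U" "\<mu> V > 0"
      using total \<mu> by (metis less_eq_real_def sum.neutral zero_neq_one)
    have "(\<Sum>V\<in>Pow U. \<mu> V * score V) < (\<Sum>V\<in>Pow U. \<mu> V * (q * card U / 4))"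
    proof (rule sum_strict_mono_ex1)
      show "\<forall>V\<in>Pow U. \<mu> V * score V \<le> \<mu> V * (q * card U / 4)"
        using \<mu> lt by (blast intro: mult_left_mono less_imp_le)
      show "\<exists>V\<in>Pow U. \<mu> V * score V < \<mu> V * (q * card U / 4)"
        using V lt by (blast intro: mult_strict_left_mono)
    qed (use U in simp)
    also have "\<dots> = q * card U / 4" unfolding sum_distrib_right[symmetric] total by simp
    finally show False using mean by simp
  qed
  then obtain V where V: "V \<subseteq> U" "q * card U / 4 \<le> score V" by auto
  let ?G = "{A \<in> V. (\<forall>B\<in>bad A. \<not> B \<subseteq> V) \<and> card {B \<in> link A. B \<subseteq> V} \<le> d}"
  have "score V \<le> (\<Sum>A\<in>U. if A \<in> ?G then 1 else 0)"
    unfolding score_def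
  proof (intro sum_mono)
    fix A assume A: "A \<in> U"
    have nn: "0 \<le> (\<Sum>B\<in>bad A. ind (insert A B) V)" "0 \<le> (\<Sum>B\<in>link A. ind (insert A B) V) / d"
      using d by (auto simp: ind_def intro!: sum_nonneg divide_nonneg_nonneg)
    show "ind {A} V - (\<Sum>B\<in>bad A. ind (insert A B) V) - (\<Sum>B\<in>link A. ind (insert A B) V) / d
        \<le> (if A \<in> ?G then 1 else 0)"
    proof (cases "A \<in> V \<and> A \<notin> ?G")
      case False
      then show ?thesis using nn by (auto simp: ind_def split: if_splits)
    next
      case True
      then have AV: "A \<in> V" by simp
      from True consider B where "B \<in> bad A" "B \<subseteq> V" | "d < card {B \<in> link A. B \<subseteq> V}"
        by (auto simp: not_le)
      then show ?thesis
      proof cases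
        case 1
        have "ind (insert A B) V \<le> (\<Sum>B\<in>bad A. ind (insert A B) V)"
          using 1 bad(1)[OF A] by (intro member_le_sum) (auto simp: ind_def)
        then show ?thesis using nn 1 AV True by (simp add: ind_def)
      next
        case 2
        have "(\<Sum>B\<in>link A. ind (insert A B) V) = card {B \<in> link A. B \<subseteq> V}"
          using AV link(1)[OF A] by (simp add: ind_def sum.inter_filter[symmetric])
        then have "1 \<le> (\<Sum>B\<in>link A. ind (insert A B) V) / d"
          using 2 d by simp
        then show ?thesis using nn AV True by (simp add: ind_def)
      qed
    qed
  qed
  also have "\<dots> = card ?G"
  proof -
    have "{A \<in> U. A \<in> ?G} = ?G" using V by auto
    then show ?thesis using U by (simp add: sum.inter_filter[symmetric])
  qed
  finally show ?thesis using that[of V] V by linarith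
qed

section \<open>Triples of sets described by one-element exchanges\<close>

definition swap :: "'a set \<Rightarrow> 'a \<Rightarrow> 'a \<Rightarrow> 'a set" where
  "swap A y x = insert y A - {x}"

lemma swap_eq_iff:
  "\<lbrakk>y \<notin> A; x \<in> A; y' \<notin> A; x' \<in> A\<rbrakk> \<Longrightarrow> swap A y x = swap A y' x' \<longleftrightarrow> y = y' \<and> x = x'"
  unfolding swap_def by blast

lemma swap_neq: "\<lbrakk>y \<notin> A; x \<in> A\<rbrakk> \<Longrightarrow> swap A y x \<noteq> A"
  unfolding swap_def by blast

lemma card_swap: "\<lbrakk>finite A; y \<notin> A; x \<in> A\<rbrakk> \<Longrightarrow> card (swap A y x) = card A"
  unfolding swap_def by (metis card_insert_disjoint card_Diff_singleton diff_Suc_1 finite_insert insertCI)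

text \<open>The vertices are \<open>r\<close>-sets. The obstructions at \<open>A\<close> are configurations that would create
  two triples through \<open>A\<close> sharing a second set, respectively a triangle of triples with corner \<open>A\<close>.\<close>

definition links :: "'a set \<Rightarrow> 'a set \<Rightarrow> 'a set set set" where
  "links X A = (\<lambda>(y, x1, x2). {swap A y x1, swap A y x2}) `
     {(y, x1, x2). y \<in> X - A \<and> x1 \<in> A \<and> x2 \<in> A \<and> x1 \<noteq> x2}"

definition overlaps :: "'a set \<Rightarrow> 'a set \<Rightarrow> 'a set set set" where
  "overlaps X A = (\<lambda>(y, x1, x2, x3). {swap A y x1, swap A y x2, swap A y x3}) `
     {(y, x1, x2, x3). y \<in> X - A \<and> x1 \<in> A \<and> x2 \<in> A \<and> x3 \<in> A \<and> x1 \<noteq> x2 \<and> x1 \<noteq> x3 \<and> x2 \<noteq> x3}"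

definition corners :: "'a set \<Rightarrow> 'a set \<Rightarrow> 'a set set set" where
  "corners X A = (\<lambda>(y, y', z, x, x'). {swap A y z, swap A y x, swap A y' z, swap A y' x'}) `
     {(y, y', z, x, x'). y \<in> X - A \<and> y' \<in> X - A \<and> y \<noteq> y' \<and> z \<in> A \<and> x \<in> A \<and> x' \<in> A
        \<and> x \<noteq> z \<and> x' \<noteq> z}"

text \<open>Different parameters may describe the same configuration, so counting parameters gives
  an upper bound.\<close>

lemma sum_power_card_image_le:
  fixes q :: real
  assumes "P \<subseteq> Q" "finite Q" "0 \<le> q" "\<And>p. p \<in> P \<Longrightarrow> card (f p) = j"
  shows "finite (f ` P)" "(\<Sum>B\<in>f ` P. q ^ card B) \<le> card Q * q ^ j"
proof -
  have finP: "finite P" using assms finite_subset by blast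
  then show "finite (f ` P)" by simp
  have "(\<Sum>B\<in>f ` P. q ^ card B) = (\<Sum>B\<in>f ` P. q ^ j)"
    using assms(4) by (intro sum.cong) auto
  also have "\<dots> = card (f ` P) * q ^ j" by simp
  also have "\<dots> \<le> card Q * q ^ j"
    using card_image_le[OF finP, of f] card_mono[OF assms(2,1)] assms(3)
    by (intro mult_right_mono) auto
  finally show "(\<Sum>B\<in>f ` P. q ^ card B) \<le> card Q * q ^ j" .
qed

context
  fixes X A :: "'a set" and q :: real and m r :: nat
  assumes X: "finite X" "card X = m" and A: "A \<subseteq> X" "card A = r" and q: "0 \<le> q"
begin

lemma finA: "finite A"
  using X A finite_subset by blast

lemma links_sum: "finite (links X A)" "(\<Sum>B\<in>links X A. q ^ card B) \<le> m * r ^ 2 * q ^ 2"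
proof -
  let ?P = "{(y, x1, x2). y \<in> X - A \<and> x1 \<in> A \<and> x2 \<in> A \<and> x1 \<noteq> x2}"
  have sub: "?P \<subseteq> X \<times> A \<times> A" "finite (X \<times> A \<times> A)" using X finA by auto
  have "card (case p of (y, x1, x2) \<Rightarrow> {swap A y x1, swap A y x2}) = 2" if "p \<in> ?P" for p
    using that by (auto simp: swap_eq_iff)
  from sum_power_card_image_le[OF sub q this]
  show "finite (links X A)" "(\<Sum>B\<in>links X A. q ^ card B) \<le> m * r ^ 2 * q ^ 2"
    unfolding links_def by (simp_all add: X A card_cartesian_product power2_eq_square mult_ac)
qed

lemma overlaps_sum: "finite (overlaps X A)" "(\<Sum>B\<in>overlaps X A. q ^ card B) \<le> m * r ^ 3 * q ^ 3"
proof -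
  let ?P = "{(y, x1, x2, x3). y \<in> X - A \<and> x1 \<in> A \<and> x2 \<in> A \<and> x3 \<in> A
    \<and> x1 \<noteq> x2 \<and> x1 \<noteq> x3 \<and> x2 \<noteq> x3}"
  have sub: "?P \<subseteq> X \<times> A \<times> A \<times> A" "finite (X \<times> A \<times> A \<times> A)" using X finA by auto
  have "card (case p of (y, x1, x2, x3) \<Rightarrow> {swap A y x1, swap A y x2, swap A y x3}) = 3"
    if "p \<in> ?P" for p
    using that by (auto simp: swap_eq_iff)
  from sum_power_card_image_le[OF sub q this]
  show "finite (overlaps X A)" "(\<Sum>B\<in>overlaps X A. q ^ card B) \<le> m * r ^ 3 * q ^ 3"
    unfolding overlaps_def by (simp_all add: X A card_cartesian_product power3_eq_cube mult_ac)
qed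

lemma corners_sum: "finite (corners X A)" "(\<Sum>B\<in>corners X A. q ^ card B) \<le> m ^ 2 * r ^ 3 * q ^ 4"
proof -
  let ?P = "{(y, y', z, x, x'). y \<in> X - A \<and> y' \<in> X - A \<and> y \<noteq> y' \<and> z \<in> A \<and> x \<in> A \<and> x' \<in> A
        \<and> x \<noteq> z \<and> x' \<noteq> z}"
  have sub: "?P \<subseteq> X \<times> X \<times> A \<times> A \<times> A" "finite (X \<times> X \<times> A \<times> A \<times> A)" using X finA by auto
  have "card (case p of (y, y', z, x, x') \<Rightarrow> {swap A y z, swap A y x, swap A y' z, swap A y' x'}) = 4"
    if "p \<in> ?P" for p
    using that by (auto simp: swap_eq_iff)
  from sum_power_card_image_le[OF sub q this]
  show "finite (corners X A)" "(\<Sum>B\<in>corners X A. q ^ card B) \<le> m ^ 2 * r ^ 3 * q ^ 4"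
    unfolding corners_def
    by (simp_all add: X A card_cartesian_product power2_eq_square power3_eq_cube mult_ac)
qed

lemma config_subset:
  assumes "B \<in> links X A \<union> (overlaps X A \<union> corners X A)"
  shows "B \<subseteq> {A. A \<subseteq> X \<and> card A = r} - {A}"
proof -
  define S where "S = {A. A \<subseteq> X \<and> card A = r} - {A}"
  have "swap A y x \<in> S" if "y \<in> X" "y \<notin> A" "x \<in> A" for y x
    using that A finA swap_neq[of y A x] card_swap[of A y x] by (auto simp: S_def swap_def)
  then show ?thesis
    using assms unfolding S_def[symmetric] by (auto simp: links_def overlaps_def corners_def)
qed

end

text \<open>For \<open>y\<close> in \<open>B\<close> but not in \<open>A\<close>, the set
  \<open>insert y A\<close> already has \<open>r + 1\<close> elements and so is the whole union;
  comparing sizes, \<open>B\<close> misses exactly one element of \<open>A\<close>.\<close>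

lemma swap_form:
  assumes "finite A" "card A = r" "card B = r" "A \<noteq> B" "finite (A \<union> B)" "card (A \<union> B) \<le> Suc r"
  obtains y x where "y \<notin> A" "x \<in> A" "A \<union> B = insert y A" "B = swap A y x"
proof -
  have finB: "finite B" using assms by auto
  have "\<not> B \<subseteq> A" using assms finB by (metis card_subset_eq)
  then obtain y where y: "y \<in> B" "y \<notin> A" by auto
  have "insert y A = A \<union> B"
    using assms y by (intro card_seteq) auto
  moreover have "\<not> A \<subseteq> B" using assms finB by (metis card_subset_eq)
  then obtain x where x: "x \<in> A" "x \<notin> B" by auto
  have "B \<subseteq> swap A y x" using \<open>insert y A = A \<union> B\<close> x by (auto simp: swap_def)
  then have "B = swap A y x"
    using assms y x finB card_swap[of A y x]
    by (intro card_subset_eq) (auto simp: swap_def)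
  ultimately show ?thesis using that x y by metis
qed

text \<open>Three \<open>r\<close>-sets with union of size \<open>r + 1\<close> are exactly the edge sets of copies of \<open>H3\<close>.\<close>

definition triples :: "nat \<Rightarrow> 'a set set \<Rightarrow> 'a set set set" where
  "triples r V = {e. e \<subseteq> V \<and> card e = 3 \<and> card (\<Union>e) = Suc r}"

lemma triples_other:
  assumes "e \<in> triples r V"
  obtains B where "B \<in> e" "B \<noteq> A"
proof -
  have "\<not> e \<subseteq> {A}" using assms card_mono[of "{A}" e] by (auto simp: triples_def)
  then show ?thesis using that by blast
qed

text \<open>The other two sets both arise from \<open>A\<close> by an exchange, and the added
  element is the same because the union of the triple is \<open>A\<close> with one further
  element.\<close>

lemma triple_form:
  assumes V: "V \<subseteq> {A. A \<subseteq> X \<and> card A = r}" and X: "finite X"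
    and e: "e \<in> triples r V" and A: "A \<in> e" and B: "B \<in> e" "B \<noteq> A"
  shows "\<exists>y x1 x2. y \<in> X - A \<and> x1 \<in> A \<and> x2 \<in> A \<and> x1 \<noteq> x2 \<and> B = swap A y x1
    \<and> e = {A, swap A y x1, swap A y x2} \<and> \<Union>e = insert y A"
proof -
  have e': "e \<subseteq> V" "card e = 3" "card (\<Union>e) = Suc r" using e by (auto simp: triples_def)
  have fe: "finite e" using e'(2) by (intro card_ge_0_finite) simp
  have UX: "\<Union>e \<subseteq> X" using e' V by blast
  then have fU: "finite (\<Union>e)" using X finite_subset by blast
  have card2: "card (e - {A} - {B}) = 1" using e' A B fe by simp
  then obtain C where eC: "e - {A} - {B} = {C}" by (auto simp: card_1_singleton_iff)
  then have "C \<in> e - {A} - {B}" by simp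
  then have C: "C \<noteq> A" "C \<noteq> B" by auto
  have "e = insert A (insert B (e - {A} - {B}))" using A B by blast
  then have e_eq: "e = {A, B, C}" unfolding eC .
  have "A \<subseteq> X" and cA: "card A = r" using A e'(1) V by blast+
  then have fA: "finite A" using X finite_subset by blast
  have form: "\<exists>y x. y \<notin> A \<and> x \<in> A \<and> \<Union>e = insert y A \<and> D = swap A y x" if D: "D \<in> e" "D \<noteq> A" for D
  proof -
    have sub: "A \<union> D \<subseteq> \<Union>e" using A D by auto
    have cD: "card D = r" using D e' V by blast
    have le: "card (A \<union> D) \<le> Suc r" using card_mono[OF fU sub] e'(3) by simp
    obtain y x where yx: "y \<notin> A" "x \<in> A" "A \<union> D = insert y A" "D = swap A y x"
      using swap_form[OF fA cA cD D(2)[symmetric] finite_subset[OF sub fU] le] by blast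
    have "card (insert y A) = Suc r" using yx fA cA by simp
    then have "insert y A = \<Union>e" using sub yx(3) e'(3) fU by (intro card_subset_eq) auto
    then show ?thesis using yx by blast
  qed
  obtain y x1 where 1: "y \<notin> A" "x1 \<in> A" "\<Union>e = insert y A" "B = swap A y x1" using form[of B] B by blast
  obtain y' x2 where 2: "y' \<notin> A" "x2 \<in> A" "\<Union>e = insert y' A" "C = swap A y' x2" using form[of C] C e_eq by blast
  have y': "y' = y" using 1 2 by blast
  have "y \<in> X" using 1(3) UX by blast
  show ?thesis
  proof (intro exI conjI)
    show "y \<in> X - A" using \<open>y \<in> X\<close> 1(1) by simp
    show "x1 \<noteq> x2" using C(2) 1(4) 2(4) y' by metis
    show "e = {A, swap A y x1, swap A y x2}" using e_eq 1(4) 2(4) y' by simp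
  qed (fact 1 2)+
qed

text \<open>A triple through \<open>A\<close> is given by an added element and two removed ones. A
  second common set fixes the added element, after which two different triples would yield an
  overlap; triangles yield corners, and removing \<open>A\<close> from a triple leaves a
  link.\<close>

lemma sparse_3graph_triples:
  assumes V: "V \<subseteq> {A. A \<subseteq> X \<and> card A = r}" and X: "finite X"
    and overlap: "\<And>A B. A \<in> V \<Longrightarrow> B \<in> overlaps X A \<Longrightarrow> \<not> B \<subseteq> V"
    and corner: "\<And>A B. A \<in> V \<Longrightarrow> B \<in> corners X A \<Longrightarrow> \<not> B \<subseteq> V"
    and link: "\<And>A. A \<in> V \<Longrightarrow> real (card {B \<in> links X A. B \<subseteq> V}) \<le> d"
  shows "sparse_3graph V (triples r V) d"
proof
  show finV: "finite V" using V X by (intro finite_subset[of V "Pow X"]) auto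
  show "e \<subseteq> V" "card e = 3" if "e \<in> triples r V" for e
    using that by (auto simp: triples_def)
  note form = triple_form[OF V X]
  have finA: "finite A" "card A = r" if "A \<in> V" for A using that V finite_subset[OF _ X] by auto
  have same: "e = f"
    if e: "e \<in> triples r V" "A \<in> e" "f \<in> triples r V" "A \<in> f" and U: "\<Union>e = \<Union>f" for e f A
  proof -
    have AV: "A \<in> V" using e by (auto simp: triples_def)
    obtain B where "B \<in> e" "B \<noteq> A" using triples_other[OF e(1)] .
    obtain C where "C \<in> f" "C \<noteq> A" using triples_other[OF e(3)] .
    obtain y x1 x2 where 1: "y \<in> X - A" "x1 \<in> A" "x2 \<in> A" "x1 \<noteq> x2"
      "e = {A, swap A y x1, swap A y x2}" "\<Union>e = insert y A"
      using form[OF e(1,2) \<open>B \<in> e\<close> \<open>B \<noteq> A\<close>] by (elim exE conjE) (rule that; assumption)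
    obtain y' x3 x4 where 2: "y' \<in> X - A" "x3 \<in> A" "x4 \<in> A" "x3 \<noteq> x4"
      "f = {A, swap A y' x3, swap A y' x4}" "\<Union>f = insert y' A"
      using form[OF e(3,4) \<open>C \<in> f\<close> \<open>C \<noteq> A\<close>] by (elim exE conjE) (rule that; assumption)
    have "insert y A = insert y' A" using 1(6) 2(6) U by simp
    then have y: "y' = y" using 1(1) 2(1) by blast
    have "e \<subseteq> V" "f \<subseteq> V" using e by (auto simp: triples_def)
    then have eV: "swap A y x1 \<in> V" "swap A y x2 \<in> V" "swap A y x3 \<in> V" "swap A y x4 \<in> V"
      unfolding 1(5) 2(5) y by auto
    \<comment> \<open>A third exchange with the same \<open>y\<close> inside \<open>V\<close> would
      complete an overlap.\<close>
    have mem: "x = x1 \<or> x = x2" if x: "x \<in> A" "swap A y x \<in> V" for x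
    proof (rule ccontr)
      assume "\<not> (x = x1 \<or> x = x2)"
      then have "{swap A y x1, swap A y x2, swap A y x} \<in> overlaps X A"
        unfolding overlaps_def using 1 x by (intro image_eqI[of _ _ "(y, x1, x2, x)"]) auto
      then show False using overlap[OF AV] eV x by blast
    qed
    have "x3 = x1 \<and> x4 = x2 \<or> x3 = x2 \<and> x4 = x1"
      using mem[OF 2(2) eV(3)] mem[OF 2(3) eV(4)] 2(4) by metis
    then show ?thesis unfolding 1(5) 2(5) y by (auto simp: insert_commute)
  qed
  have linear: "e = f"
    if e: "e \<in> triples r V" "f \<in> triples r V" "A \<in> e" "A \<in> f" "B \<in> e" "B \<in> f" "A \<noteq> B" for e f A B
  proof -
    obtain y x1 where 1: "y \<in> X - A" "x1 \<in> A" "B = swap A y x1" "\<Union>e = insert y A"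
      using form[OF e(1,3,5) e(7)[symmetric]] by (elim exE conjE) (rule that; assumption)
    obtain y' x3 where 2: "y' \<in> X - A" "x3 \<in> A" "B = swap A y' x3" "\<Union>f = insert y' A"
      using form[OF e(2,4,6) e(7)[symmetric]] by (elim exE conjE) (rule that; assumption)
    have "y = y'" using 1 2 swap_eq_iff[of y A x1 y' x3] by auto
    then show ?thesis using same[OF e(1,3,2,4)] 1 2 by simp
  qed
  show "e = f"
    if "e \<in> triples r V" "f \<in> triples r V" "u \<in> e" "u \<in> f" "w \<in> e" "w \<in> f" "u \<noteq> w" for e f u w
    using linear[OF that] .
  show False
    if e: "e \<in> triples r V" and f: "f \<in> triples r V" and ef: "e \<noteq> f" and v: "v \<in> e" "v \<in> f"
      and u: "u \<in> e" "u \<noteq> v" and w: "w \<in> f" "w \<noteq> v" and g: "g \<in> triples r V" "u \<in> g" "w \<in> g"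
    for e f v u w g
  proof -
    have vV: "v \<in> V" using e v by (auto simp: triples_def)
    obtain y x1 x2 where 1: "y \<in> X - v" "x1 \<in> v" "x2 \<in> v" "x1 \<noteq> x2" "u = swap v y x1"
      "e = {v, swap v y x1, swap v y x2}" "\<Union>e = insert y v"
      using form[OF e v(1) u] by (elim exE conjE) (rule that; assumption)
    obtain y' x3 x4 where 2: "y' \<in> X - v" "x3 \<in> v" "x4 \<in> v" "x3 \<noteq> x4" "w = swap v y' x3"
      "f = {v, swap v y' x3, swap v y' x4}" "\<Union>f = insert y' v"
      using form[OF f v(2) w] by (elim exE conjE) (rule that; assumption)
    have y: "y \<noteq> y'" using same[OF e v(1) f v(2)] 1(7) 2(7) ef by metis
    \<comment> \<open>Since \<open>u\<close> and \<open>w\<close> lie in the common triple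
      \<open>g\<close>, their union has at most \<open>r + 1\<close> elements. Different removed
      elements would make it contain \<open>v\<close>, \<open>y\<close> and
      \<open>y'\<close>.\<close>
    have "x1 = x3"
    proof (rule ccontr)
      assume x: "x1 \<noteq> x3"
      have "u \<union> w = insert y (insert y' v)"
        unfolding 1(5) 2(5) swap_def using 1(2) 2(2) x by blast
      then have "card (u \<union> w) = Suc (Suc r)"
        using 1(1) 2(1) y finA[OF vV] by simp
      moreover have "u \<union> w \<subseteq> \<Union>g" using g by auto
      moreover have cg: "card (\<Union>g) = Suc r" using g by (simp add: triples_def)
      moreover have "finite (\<Union>g)" using cg by (intro card_ge_0_finite) simp
      ultimately show False using card_mono[of "\<Union>g" "u \<union> w"] by simp
    qed
    then have "{swap v y x1, swap v y x2, swap v y' x1, swap v y' x4} \<in> corners X v"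
      unfolding corners_def using 1 2 y by (intro image_eqI[of _ _ "(y, y', x1, x2, x4)"]) auto
    moreover have "{swap v y x1, swap v y x2, swap v y' x1, swap v y' x4} \<subseteq> V"
    proof -
      have "e \<subseteq> V" "f \<subseteq> V" using e f by (auto simp: triples_def)
      then show ?thesis unfolding 1(6) 2(6) \<open>x1 = x3\<close> by auto
    qed
    ultimately show False using corner[OF vV] by blast
  qed
  show "real (card {e \<in> triples r V. A \<in> e}) \<le> d" if A: "A \<in> V" for A
  proof -
    have "card {e \<in> triples r V. A \<in> e} \<le> card {B \<in> links X A. B \<subseteq> V}"
    proof (rule card_inj_on_le)
      show "inj_on (\<lambda>e. e - {A}) {e \<in> triples r V. A \<in> e}" by (auto simp: inj_on_def)
      show "finite {B \<in> links X A. B \<subseteq> V}" using finV by simp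
      show "(\<lambda>e. e - {A}) ` {e \<in> triples r V. A \<in> e} \<subseteq> {B \<in> links X A. B \<subseteq> V}"
      proof clarify
        fix e assume e: "e \<in> triples r V" "A \<in> e"
        obtain B where "B \<in> e" "B \<noteq> A" using triples_other[OF e(1)] .
        obtain y x1 x2 where 1: "y \<in> X - A" "x1 \<in> A" "x2 \<in> A" "x1 \<noteq> x2"
          "e = {A, swap A y x1, swap A y x2}"
          using form[OF e \<open>B \<in> e\<close> \<open>B \<noteq> A\<close>] by (elim exE conjE) (rule that; assumption)
        have "swap A y x1 \<noteq> A" "swap A y x2 \<noteq> A" using 1(1-3) by (simp_all add: swap_neq)
        then have "e - {A} = {swap A y x1, swap A y x2}" unfolding 1(5) by auto
        then have "e - {A} \<in> links X A"
          unfolding links_def using 1 by (intro image_eqI[of _ _ "(y, x1, x2)"]) auto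
        moreover have "e - {A} \<subseteq> V" using e by (auto simp: triples_def)
        ultimately show "e - {A} \<in> links X A \<and> e - {A} \<subseteq> V" ..
      qed
    qed
    then show ?thesis using link[OF A] by linarith
  qed
qed

text \<open>Sparsification keeps a fraction \<open>q / 4\<close> of all sets, and
  \<open>exists_independent\<close> keeps a fraction \<open>sqrt (ln d / d) / 64\<close> of those.
  The assumptions bound the expected overlaps and corners at a set by 1/4 each, and \<open>d\<close>
  is four times the bound on the expected links.\<close>

lemma exists_H3_free_family:
  fixes q :: real
  assumes X: "finite X" "card X = m" and m: "0 < m" "0 < r" and q: "0 < q" "q \<le> 1"
    and q3: "m * r ^ 3 * q ^ 3 \<le> 1/4" and q4: "m ^ 2 * r ^ 3 * q ^ 4 \<le> 1/4"
    and d: "1 \<le> d" "d = 4 * (m * r ^ 2 * q ^ 2)"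
  obtains I where "\<And>A. A \<in> I \<Longrightarrow> A \<subseteq> X \<and> card A = r"
    "\<And>W A B C. \<lbrakk>card W = Suc r; {A, B, C} \<subseteq> I; A \<subseteq> W; B \<subseteq> W; C \<subseteq> W;
      A \<noteq> B; A \<noteq> C; B \<noteq> C\<rbrakk> \<Longrightarrow> False"
    "sqrt (ln d / d) * q * (m choose r) / 256 \<le> card I"
proof -
  define U where "U = {A. A \<subseteq> X \<and> card A = r}"
  have U: "finite U" "card U = m choose r" using X by (simp_all add: U_def n_subsets)
  note sums = links_sum[OF X] overlaps_sum[OF X] corners_sum[OF X]
  obtain V where V: "V \<subseteq> U" "q * card U / 4
    \<le> card {A \<in> V. (\<forall>B\<in>overlaps X A \<union> corners X A. \<not> B \<subseteq> V) \<and> card {B \<in> links X A. B \<subseteq> V} \<le> d}"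
  proof (rule random_sparsification[of U q d "\<lambda>A. overlaps X A \<union> corners X A" "links X"])
    fix A assume "A \<in> U"
    then have A: "A \<subseteq> X" "card A = r" by (auto simp: U_def)
    show fin: "finite (overlaps X A \<union> corners X A)" "finite (links X A)"
      using sums(1,3,5)[OF A less_imp_le[OF q(1)]] by auto
    show "(\<Sum>B\<in>links X A. q ^ card B) \<le> d / 4"
      using sums(2)[OF A less_imp_le[OF q(1)]] d by simp
    have "(\<Sum>B\<in>overlaps X A \<union> corners X A. q ^ card B)
        \<le> (\<Sum>B\<in>overlaps X A. q ^ card B) + (\<Sum>B\<in>corners X A. q ^ card B)"
      using fin q by (subst sum_Un) (auto intro: sum_nonneg)
    then show "(\<Sum>B\<in>overlaps X A \<union> corners X A. q ^ card B) \<le> 1/2"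
      using order_trans[OF sums(4)[OF A less_imp_le[OF q(1)]], of "1/4"]
        order_trans[OF sums(6)[OF A less_imp_le[OF q(1)]], of "1/4"] q3 q4 by simp
    show "B \<subseteq> U - {A}" if "B \<in> overlaps X A \<union> corners X A" for B
      unfolding U_def using config_subset[OF X A] that by blast
    show "B \<subseteq> U - {A}" if "B \<in> links X A" for B
      unfolding U_def using config_subset[OF X A] that by blast
  qed (use U q d in auto)
  \<comment> \<open>Configurations inside \<open>V'\<close> also lie inside \<open>V\<close>, so
    discarding the sets that are not good preserves the guarantees of the remaining ones.\<close>
  define V' where "V' = {A \<in> V. (\<forall>B\<in>overlaps X A \<union> corners X A. \<not> B \<subseteq> V)
    \<and> card {B \<in> links X A. B \<subseteq> V} \<le> d}"
  have V'V: "V' \<subseteq> V" by (auto simp: V'_def)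
  have finV: "finite V" using V U finite_subset by blast
  interpret sparse_3graph V' "triples r V'" d
  proof (rule sparse_3graph_triples)
    show "V' \<subseteq> {A. A \<subseteq> X \<and> card A = r}"
      using V V'V by (auto simp: U_def)
    show "\<not> B \<subseteq> V'" if "A \<in> V'" "B \<in> overlaps X A" for A B
      using that V'V by (auto simp: V'_def)
    show "\<not> B \<subseteq> V'" if "A \<in> V'" "B \<in> corners X A" for A B
      using that V'V by (auto simp: V'_def)
    show "real (card {B \<in> links X A. B \<subseteq> V'}) \<le> d" if "A \<in> V'" for A
    proof -
      have "card {B \<in> links X A. B \<subseteq> V'} \<le> card {B \<in> links X A. B \<subseteq> V}"
        using V'V finV by (intro card_mono) (auto intro: finite_subset[of _ "Pow V"])
      then show ?thesis using that by (auto simp: V'_def)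
    qed
  qed (rule X)
  obtain I where I: "I \<subseteq> V'" "\<And>e. e \<in> triples r V' \<Longrightarrow> \<not> e \<subseteq> I"
    "sqrt (ln d / d) / 64 * card V' \<le> card I"
    using exists_independent[OF d(1)] by blast
  have IU: "A \<subseteq> X \<and> card A = r" if "A \<in> I" for A
    using that subsetD[OF I(1)] subsetD[OF V'V] subsetD[OF V(1)] unfolding U_def by blast
  show ?thesis
  proof (rule that)
    show "A \<subseteq> X \<and> card A = r" if "A \<in> I" for A using IU[OF that] .
    show False if W: "card W = Suc r" "{A, B, C} \<subseteq> I" "A \<subseteq> W" "B \<subseteq> W" "C \<subseteq> W"
      "A \<noteq> B" "A \<noteq> C" "B \<noteq> C" for W A B C
    proof -
      have fW: "finite W" using W(1) by (intro card_ge_0_finite) simp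
      have AB: "card A = r" "card B = r" "finite A" "finite B"
        using IU[of A] IU[of B] W(2) finite_subset[OF W(3) fW] finite_subset[OF W(4) fW] by simp_all
      \<comment> \<open>Two distinct \<open>r\<close>-sets already have a union of size at least
        \<open>r + 1\<close>, so three inside \<open>W\<close> have union \<open>W\<close> and form
        a triple.\<close>
      have "\<not> B \<subseteq> A" using card_subset_eq[of A B] AB W(6) by auto
      then have "A \<subset> A \<union> B" by auto
      then have "r < card (A \<union> B)" using AB psubset_card_mono[of "A \<union> B" A] by auto
      also have "card (A \<union> B) \<le> card (\<Union>{A, B, C})"
        using finite_subset[of _ W] W(3-5) fW by (intro card_mono) auto
      finally have "Suc r \<le> card (\<Union>{A, B, C})" by simp
      moreover have "card (\<Union>{A, B, C}) \<le> card W" using W(3-5) fW by (intro card_mono) auto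
      ultimately have "card (\<Union>{A, B, C}) = Suc r" using W(1) by simp
      moreover have "card {A, B, C} = 3" using W(6-8) by simp
      ultimately have "{A, B, C} \<in> triples r V'"
        unfolding triples_def using order_trans[OF W(2) I(1)] by blast
      then show False using I(2) W(2) by blast
    qed
    have "sqrt (ln d / d) * q * (m choose r) / 256 = sqrt (ln d / d) / 64 * (q * card U / 4)"
      using U by simp
    also have "\<dots> \<le> sqrt (ln d / d) / 64 * card V'"
      using V(2) d unfolding V'_def[symmetric] by (intro mult_left_mono) auto
    also note I(3)
    finally show "sqrt (ln d / d) * q * (m choose r) / 256 \<le> card I" .
  qed
qed

section \<open>Turan densities and blow-ups\<close>

lemma card_edges_le:
  "r_graph r G \<Longrightarrow> card (verts G) = n \<Longrightarrow> card (edges G) \<le> n choose r"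
proof -
  assume *: "r_graph r G" "card (verts G) = n"
  then have "edges G \<subseteq> {A. A \<subseteq> verts G \<and> card A = r}" "finite (verts G)"
    by (auto simp: r_graph_def)
  then have "card (edges G) \<le> card {A. A \<subseteq> verts G \<and> card A = r}"
    by (intro card_mono) auto
  with * show ?thesis by (simp add: n_subsets r_graph_def)
qed

lemma finite_turan_set:
  fixes H :: "'a hypergraph"
  shows "finite {card (edges G) | G :: nat hypergraph. r_graph r G \<and> card (verts G) = n \<and> H_free H G}"
  by (rule finite_subset[of _ "{..n choose r}"]) (auto intro: card_edges_le)

lemma ex_turan_ge:
  fixes G :: "nat hypergraph"
  shows "r_graph r G \<Longrightarrow> card (verts G) = n \<Longrightarrow> H_free H G \<Longrightarrow> card (edges G) \<le> ex_turan r n H"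
  unfolding ex_turan_def by (rule Max_ge[OF finite_turan_set]) auto

lemma H_free_edgeless:
  assumes "edges H \<noteq> {}" "edges G = {}"
  shows "H_free H G"
  using assms by (auto simp: H_free_def subhypergraph_def isomorphic_def)

lemma ex_turan_attained:
  assumes "edges H \<noteq> {}"
  obtains G :: "nat hypergraph" where "r_graph r G" "card (verts G) = n" "H_free H G"
    "card (edges G) = ex_turan r n H"
proof -
  let ?A = "{card (edges G) | G :: nat hypergraph. r_graph r G \<and> card (verts G) = n \<and> H_free H G}"
  \<comment> \<open>The edgeless graph shows that the maximum is taken over a nonempty set.\<close>
  let ?G = "\<lparr>verts = {..<n}, edges = {}\<rparr> :: nat hypergraph"
  have "r_graph r ?G" "card (verts ?G) = n" "H_free H ?G"
    using assms H_free_edgeless[of H ?G] by (simp_all add: r_graph_def)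
  then have "?A \<noteq> {}" by blast
  then have "ex_turan r n H \<in> ?A"
    unfolding ex_turan_def by (intro Max_in finite_turan_set)
  then show ?thesis using that by auto
qed

lemma H_free_delete_vertex:
  assumes "H_free H G"
  shows "H_free H \<lparr>verts = verts G - {v}, edges = {e \<in> edges G. v \<notin> e}\<rparr>"
  using assms by (auto simp: H_free_def subhypergraph_def)

text \<open>Averaging over vertex deletions in an extremal graph: every edge survives
  \<open>Suc n - r\<close> of the \<open>Suc n\<close> deletions, and each deletion leaves an
  \<open>H\<close>-free graph on \<open>n\<close> vertices.\<close>

lemma ex_turan_Suc:
  assumes H: "edges H \<noteq> {}" and rn: "r \<le> n"
  shows "ex_turan r (Suc n) H * (Suc n - r) \<le> ex_turan r n H * Suc n"
proof -
  obtain G :: "nat hypergraph" where G: "r_graph r G" "card (verts G) = Suc n" "H_free H G"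
    "card (edges G) = ex_turan r (Suc n) H"
    using ex_turan_attained[OF H] .
  have fin: "finite (verts G)" using G by (simp add: r_graph_def)
  have finE: "finite (edges G)"
    using G fin by (intro finite_subset[of "edges G" "Pow (verts G)"]) (auto simp: r_graph_def)
  have "ex_turan r (Suc n) H * (Suc n - r) = (\<Sum>e\<in>edges G. card (verts G - e))"
  proof -
    have "card (verts G - e) = Suc n - r" if "e \<in> edges G" for e
      using that G(1,2) finite_subset[OF _ fin] by (subst card_Diff_subset) (auto simp: r_graph_def)
    then show ?thesis using G(4) by simp
  qed
  also have "\<dots> = (\<Sum>e\<in>edges G. \<Sum>v\<in>verts G. if v \<notin> e then 1 else 0)"
    using fin by (intro sum.cong refl) (simp add: sum.inter_filter[symmetric] set_diff_eq)
  also have "\<dots> = (\<Sum>v\<in>verts G. \<Sum>e\<in>edges G. if v \<notin> e then 1 else 0)"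
    by (rule sum.swap)
  also have "\<dots> = (\<Sum>v\<in>verts G. card {e \<in> edges G. v \<notin> e})"
    using finE by (simp add: sum.inter_filter[symmetric])
  also have "\<dots> \<le> (\<Sum>v\<in>verts G. ex_turan r n H)"
  proof (intro sum_mono)
    fix v assume v: "v \<in> verts G"
    let ?G = "\<lparr>verts = verts G - {v}, edges = {e \<in> edges G. v \<notin> e}\<rparr>"
    have "card (edges ?G) \<le> ex_turan r n H"
      using G v fin by (intro ex_turan_ge H_free_delete_vertex) (auto simp: r_graph_def)
    then show "card {e \<in> edges G. v \<notin> e} \<le> ex_turan r n H" by simp
  qed
  finally show ?thesis using G(2) by (simp add: mult.commute)
qed

lemma ex_turan_ratio_Suc:
  assumes H: "edges H \<noteq> {}" and rn: "r \<le> n"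
  shows "real (ex_turan r (Suc n) H) / real (Suc n choose r) \<le> real (ex_turan r n H) / real (n choose r)"
proof -
  have pos: "0 < (n choose r)" "0 < (Suc n choose r)" "0 < Suc n - r"
    using rn by (auto simp: zero_less_binomial_iff)
  have absorb: "Suc n * (n choose r) = (Suc n choose r) * (Suc n - r)"
    using binomial_absorb_comp[of "Suc n" r] by (simp add: mult.commute)
  have "ex_turan r (Suc n) H * (n choose r) * Suc n
      = ex_turan r (Suc n) H * (Suc n - r) * (Suc n choose r)"
  proof -
    have "ex_turan r (Suc n) H * (n choose r) * Suc n = ex_turan r (Suc n) H * (Suc n * (n choose r))"
      by (simp only: mult_ac)
    then show ?thesis unfolding absorb by (simp only: mult_ac)
  qed
  also have "\<dots> \<le> ex_turan r n H * Suc n * (Suc n choose r)"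
    using ex_turan_Suc[OF assms] by (rule mult_right_mono) simp
  finally have "ex_turan r (Suc n) H * (n choose r) * Suc n \<le> ex_turan r n H * (Suc n choose r) * Suc n"
    by (simp only: mult_ac)
  then have "ex_turan r (Suc n) H * (n choose r) \<le> ex_turan r n H * (Suc n choose r)"
    by (rule mult_right_le_imp_le) simp
  then have "real (ex_turan r (Suc n) H) * real (n choose r) \<le> real (ex_turan r n H) * real (Suc n choose r)"
    by (metis of_nat_mult of_nat_le_iff)
  then show ?thesis using pos by (simp add: divide_simps)
qed

text \<open>The densities decrease from \<open>n = r\<close> on and are nonnegative, so they
  converge, and a bound along the multiples of \<open>m\<close> passes to all smaller
  \<open>n\<close>.\<close>

lemma turan_density_ge:
  assumes H: "edges H \<noteq> {}" and m: "0 < m"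
    and ge: "\<And>k. 0 < k \<Longrightarrow> a \<le> real (ex_turan r (m * k) H) / real (m * k choose r)"
  shows "a \<le> turan_density r H"
proof -
  define f where "f n = real (ex_turan r n H) / real (n choose r)" for n
  have f_Suc: "f (Suc n) \<le> f n" if "r \<le> n" for n
    unfolding f_def by (rule ex_turan_ratio_Suc[OF H that])
  have dec: "f n' \<le> f n" if "r \<le> n" "n \<le> n'" for n n'
    using that(2)
  proof (induction n' rule: dec_induct)
    case (step k)
    then have "f (Suc k) \<le> f k" using f_Suc that(1) by simp
    with step.IH show ?case by simp
  qed simp
  \<comment> \<open>For \<open>n < r\<close> the quotient is 0 by division by zero, so monotonicity
    begins only at \<open>r\<close>.\<close>
  have "decseq (\<lambda>n. f (n + r))"
    unfolding decseq_def using dec by auto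
  moreover have "0 \<le> f (n + r)" for n by (simp add: f_def)
  ultimately have "convergent (\<lambda>n. f (n + r))"
    by (metis decseq_convergent convergent_def)
  then have "convergent f" by (simp add: convergent_ignore_initial_segment)
  then have lim: "f \<longlonglongrightarrow> turan_density r H"
    unfolding turan_density_def f_def by (simp add: convergent_LIMSEQ_iff)
  have "a \<le> f n" if n: "r \<le> n" "0 < n" for n
  proof -
    have "a \<le> f (m * n)" unfolding f_def using n by (intro ge) auto
    also have "\<dots> \<le> f n" using m n by (intro dec) auto
    finally show ?thesis .
  qed
  then show ?thesis
    by (intro LIMSEQ_le_const[OF lim] exI[of _ "Suc r"]) auto
qed

section \<open>Copies of \<open>H3\<close> and the blow-up of a triple-free family\<close>

lemma is_H3_edges_nonempty: "is_H3 r H \<Longrightarrow> edges H \<noteq> {}"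
  by (auto simp: is_H3_def)

text \<open>A copy of \<open>H3\<close> has \<open>r + 1\<close> vertices and three distinct edges
  among them, which is the configuration that \<open>free\<close> excludes.\<close>

lemma H_free_H3I:
  fixes H :: "'a hypergraph" and G :: "'b hypergraph"
  assumes H: "is_H3 r H"
    and free: "\<And>W e1 e2 e3. \<lbrakk>card W = Suc r; {e1, e2, e3} \<subseteq> edges G; e1 \<subseteq> W; e2 \<subseteq> W; e3 \<subseteq> W;
      e1 \<noteq> e2; e1 \<noteq> e3; e2 \<noteq> e3\<rbrakk> \<Longrightarrow> False"
  shows "H_free H G"
  unfolding H_free_def
proof
  assume "\<exists>K. subhypergraph K G \<and> isomorphic H K"
  then obtain K f where K: "subhypergraph K G" and f: "bij_betw f (verts H) (verts K)"
    "(\<lambda>e. f ` e) ` edges H = edges K"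
    by (auto simp: isomorphic_def)
  have "card (verts K) = Suc r"
    using H bij_betw_same_card[OF f(1)] by (simp add: is_H3_def)
  moreover have "card (edges K) = 3"
  proof -
    have "inj_on (\<lambda>e. f ` e) (edges H)"
      using f(1) H by (intro inj_onI) (auto simp: is_H3_def r_graph_def bij_betw_def inj_on_image_eq_iff)
    then have "card ((\<lambda>e. f ` e) ` edges H) = card (edges H)" by (rule card_image)
    then show ?thesis using f(2) H by (simp add: is_H3_def)
  qed
  then obtain e1 e2 e3 where "edges K = {e1, e2, e3}" "e1 \<noteq> e2" "e1 \<noteq> e3" "e2 \<noteq> e3"
    by (auto simp: card_3_iff)
  ultimately show False
    using free[of "verts K" e1 e2 e3] K by (auto simp: subhypergraph_def)
qed

text \<open>Vertex \<open>a < m\<close> is replaced by its residue class modulo \<open>m\<close>.\<close>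

lemma ex_turan_blowup:
  fixes H :: "'a hypergraph"
    and I :: "nat set set" and m r :: nat
  assumes H: "is_H3 r H" and r: "2 \<le> r" and m: "0 < m"
    and I: "\<And>A. A \<in> I \<Longrightarrow> A \<subseteq> {..<m} \<and> card A = r"
    and free: "\<And>W A B C. \<lbrakk>card W = Suc r; {A, B, C} \<subseteq> I; A \<subseteq> W; B \<subseteq> W; C \<subseteq> W;
      A \<noteq> B; A \<noteq> C; B \<noteq> C\<rbrakk> \<Longrightarrow> False"
  shows "card I * k ^ r \<le> ex_turan r (m * k) H"
proof -
  \<comment> \<open>The function \<open>g\<close> picks the copy \<open>a + m * g a\<close> of each
    \<open>a\<close> in \<open>A\<close>; remainder and quotient by \<open>m\<close> recover
    \<open>a\<close> and \<open>g a\<close>.\<close>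
  define lift where "lift = (\<lambda>(A, g). (\<lambda>a. a + m * g a) ` A :: nat set)"
  \<comment> \<open>Extensional functions make the choice unique off \<open>A\<close>, so each
    \<open>A\<close> has exactly \<open>k ^ r\<close> lifts.\<close>
  define D where "D = Sigma I (\<lambda>A. A \<rightarrow>\<^sub>E {..<k})"
  define G where "G = \<lparr>verts = {..<m * k}, edges = lift ` D\<rparr>"
  have finI: "finite I" using I by (intro finite_subset[of I "Pow {..<m}"]) auto
  have finA: "finite A" if "A \<in> I" for A using I[OF that] finite_subset by blast
  have md: "(a + m * g) mod m = a" "(a + m * g) div m = g" if "a < m" for a g
    using that by auto
  have mod_lift: "(\<lambda>x. x mod m) ` lift (A, g) = A" if "A \<in> I" for A g
    using I[OF that] md by (force simp: lift_def image_image subset_iff)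
  have inj_lift: "inj_on (\<lambda>x. x mod m) (lift (A, g))" if "A \<in> I" for A g
    using I[OF that] md by (auto simp: lift_def inj_on_def subset_iff)
  have "inj_on lift D"
  proof (rule inj_onI, clarify)
    fix A g B h assume AB: "(A, g) \<in> D" "(B, h) \<in> D" and eq: "lift (A, g) = lift (B, h)"
    then have mem: "A \<in> I" "B \<in> I" "g \<in> A \<rightarrow>\<^sub>E {..<k}" "h \<in> B \<rightarrow>\<^sub>E {..<k}" by (auto simp: D_def)
    then have [simp]: "B = A" using mod_lift eq by metis
    have "g a = h a" if a: "a \<in> A" for a
    proof -
      have "a + m * g a \<in> lift (A, h)" using eq a by (force simp: lift_def)
      then obtain b where b: "b \<in> A" "a + m * g a = b + m * h b" by (auto simp: lift_def)
      have "a < m" "b < m" using I[OF mem(1)] a b(1) by auto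
      then have "a = b" "g a = h b" using b(2) md by metis+
      then show ?thesis by simp
    qed
    then have "g = h" using mem by (intro PiE_ext[of g A _ h]) auto
    then show "A = B \<and> g = h" by simp
  qed
  then have "card (edges G) = card D" by (simp add: G_def card_image)
  also have "\<dots> = (\<Sum>A\<in>I. card (A \<rightarrow>\<^sub>E {..<k}))"
    unfolding D_def using finI finA by (intro card_SigmaI) (auto intro!: finite_PiE)
  also have "\<dots> = (\<Sum>A\<in>I. k ^ r)"
    using finA I by (intro sum.cong) (auto simp: card_PiE)
  finally have card: "card (edges G) = card I * k ^ r" by simp
  have lift_sub: "lift (A, g) \<subseteq> {..<m * k}" if "A \<in> I" "g \<in> A \<rightarrow>\<^sub>E {..<k}" for A g
  proof -
    have "a + m * g a < m * k" if "a \<in> A" for a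
    proof -
      have "a < m" "Suc (g a) \<le> k" using that I[OF \<open>A \<in> I\<close>] \<open>g \<in> _\<close> by (auto simp: PiE_def Pi_def)
      then have "a + m * g a < m * Suc (g a)" by simp
      also have "\<dots> \<le> m * k" using \<open>Suc (g a) \<le> k\<close> by (rule mult_le_mono2)
      finally show ?thesis .
    qed
    then show ?thesis by (auto simp: lift_def)
  qed
  have "r_graph r G"
    unfolding r_graph_def
  proof (intro conjI ballI)
    show "finite (verts G)" by (simp add: G_def)
    fix e assume "e \<in> edges G"
    then obtain A g where e: "e = lift (A, g)" "A \<in> I" "g \<in> A \<rightarrow>\<^sub>E {..<k}" by (auto simp: G_def D_def)
    then show "e \<subseteq> verts G" using lift_sub by (simp add: G_def)
    show "card e = r" using card_image[OF inj_lift[OF e(2), of g]] mod_lift[OF e(2), of g] I[OF e(2)] e(1) by simp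
  qed
  moreover have "H_free H G"
  proof (rule H_free_H3I[OF H])
    fix W e1 e2 e3
    assume W: "card W = Suc r" and e: "{e1, e2, e3} \<subseteq> edges G" and sub: "e1 \<subseteq> W" "e2 \<subseteq> W" "e3 \<subseteq> W"
      and neq: "e1 \<noteq> e2" "e1 \<noteq> e3" "e2 \<noteq> e3"
    let ?p = "\<lambda>x. x mod m"
    have fW: "finite W" using W card.infinite by fastforce
    have edge: "?p ` e \<in> I \<and> inj_on ?p e" if "e \<in> edges G" for e
      using that mod_lift inj_lift by (auto simp: G_def D_def)
    have miss: "\<exists>x. e = W - {x} \<and> x \<in> W" if "e \<in> edges G" "e \<subseteq> W" for e
    proof -
      have "card e = r" using \<open>r_graph r G\<close> that by (simp add: r_graph_def)
      then have "card (W - e) = 1" using that fW W finite_subset by (subst card_Diff_subset) auto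
      then obtain x where "W - e = {x}" by (auto simp: card_1_singleton_iff)
      then show ?thesis using that by (intro exI[of _ x]) auto
    qed
    obtain x1 x2 x3 where x: "e1 = W - {x1}" "e2 = W - {x2}" "e3 = W - {x3}" "x1 \<in> W" "x2 \<in> W" "x3 \<in> W"
      using miss[of e1] miss[of e2] miss[of e3] e sub by auto
    \<comment> \<open>The edges omit three distinct points of \<open>W\<close>, so at least one edge
      contains both \<open>u\<close> and \<open>v\<close>, and residues are injective on each
      edge.\<close>
    have inj: "inj_on ?p W"
    proof (rule inj_onI)
      fix u v assume uv: "u \<in> W" "v \<in> W" "?p u = ?p v"
      have "\<exists>e\<in>{e1, e2, e3}. u \<in> e \<and> v \<in> e" using x uv neq by auto
      then show "u = v" using edge e uv by (auto simp: inj_on_def)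
    qed
    show False
    proof (rule free[of "?p ` W" "?p ` e1" "?p ` e2" "?p ` e3"])
      show "card (?p ` W) = Suc r" using card_image[OF inj] W by simp
      show "{?p ` e1, ?p ` e2, ?p ` e3} \<subseteq> I" using edge e by auto
      show "?p ` e1 \<subseteq> ?p ` W" "?p ` e2 \<subseteq> ?p ` W" "?p ` e3 \<subseteq> ?p ` W" using sub by auto
      show "?p ` e1 \<noteq> ?p ` e2" "?p ` e1 \<noteq> ?p ` e3" "?p ` e2 \<noteq> ?p ` e3"
        using inj_on_image_eq_iff[OF inj] sub neq by auto
    qed
  qed
  moreover have "card (verts G) = m * k" by (simp add: G_def)
  ultimately show ?thesis using ex_turan_ge[of r G "m * k" H] card by simp
qed

text \<open>The blow-up has \<open>card I * k ^ r\<close> edges, while the number of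
  \<open>r\<close>-subsets of its vertices is at most \<open>(m * k) ^ r / fact r\<close>.\<close>

lemma turan_density_H3_ge:
  fixes H :: "'a hypergraph"
    and I :: "nat set set" and m r :: nat
  assumes H: "is_H3 r H" and r: "2 \<le> r" and m: "0 < m"
    and I: "\<And>A. A \<in> I \<Longrightarrow> A \<subseteq> {..<m} \<and> card A = r"
    and free: "\<And>W A B C. \<lbrakk>card W = Suc r; {A, B, C} \<subseteq> I; A \<subseteq> W; B \<subseteq> W; C \<subseteq> W;
      A \<noteq> B; A \<noteq> C; B \<noteq> C\<rbrakk> \<Longrightarrow> False"
  shows "card I * fact r / m ^ r \<le> turan_density r H"
proof (rule turan_density_ge[OF is_H3_edges_nonempty[OF H] m])
  fix k :: nat assume k: "0 < k"
  let ?n = "m * k"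
  show "card I * fact r / m ^ r \<le> real (ex_turan r ?n H) / real (?n choose r)"
  proof (cases "?n choose r = 0")
    \<comment> \<open>The quotient is then 0 by division by zero, and the bound holds since
      \<open>I\<close> must be empty.\<close>
    case True
    then have "card I * k ^ r = 0"
    proof -
      have "I = {}"
      proof (rule ccontr)
        assume "I \<noteq> {}"
        then obtain A where "A \<in> I" by auto
        then have "r \<le> m" using I[of A] card_mono[of "{..<m}" A] by auto
        also have "m \<le> ?n" using k by simp
        finally show False using True by (simp add: binomial_eq_0_iff)
      qed
      then show ?thesis by simp
    qed
    then show ?thesis using k by simp
  next
    case False
    have blowup: "card I * k ^ r \<le> ex_turan r ?n H"
    proof (rule ex_turan_blowup[OF H r m])
      show "A \<subseteq> {..<m} \<and> card A = r" if "A \<in> I" for A using I that .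
    qed (rule free)
    have "(?n choose r) * fact r \<le> ?n ^ r" by (rule binomial_fact_pow)
    then have "real (?n choose r) * fact r \<le> real ?n ^ r"
      by (metis of_nat_fact of_nat_le_iff of_nat_mult of_nat_power)
    then have *: "real (?n choose r) * fact r \<le> real m ^ r * real k ^ r"
      by (simp add: power_mult_distrib)
    have "card I * fact r / m ^ r * real (?n choose r) = card I / m ^ r * (real (?n choose r) * fact r)"
      by simp
    also have "\<dots> \<le> card I / m ^ r * (real m ^ r * real k ^ r)"
      using * by (intro mult_left_mono) auto
    also have "\<dots> = card I * k ^ r" using m by simp
    also have "\<dots> \<le> real (ex_turan r ?n H)"
      using blowup by (simp only: of_nat_le_iff)
    finally show ?thesis using False by (simp add: pos_le_divide_eq)
  qed
qed

text \<open>With \<open>m = 2 * r ^ 2\<close>, each of the \<open>r\<close> factors of the falling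
  factorial is at least \<open>m - r = m * (1 - 1 / (2 * r))\<close>, and Bernoulli's inequality
  bounds the \<open>r\<close>-th power of the bracket below by 1/2.\<close>

lemma binomial_fact_ge:
  assumes "0 < r"
  shows "real (2 * r ^ 2) ^ r / 2 \<le> real (2 * r ^ 2 choose r) * fact r"
proof -
  define m where "m = 2 * r ^ 2"
  have rm: "r \<le> m" using assms by (simp add: m_def power2_eq_square)
  have "real (m choose r) * fact r = (\<Prod>i<r. real (m - i))"
  proof -
    have "real (m choose r) = (\<Prod>i<r. real (m - i) / real (r - i))"
      using rm by (simp add: binomial_altdef_of_nat of_nat_diff atLeast0LessThan)
    moreover have "(fact r :: real) = (\<Prod>i<r. real (r - i))"
      by (simp add: fact_prod_rev atLeast0LessThan)
    ultimately show ?thesis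
      by (simp add: prod.distrib[symmetric])
  qed
  moreover have "(\<Prod>i<r. real (m - r)) \<le> (\<Prod>i<r. real (m - i))"
    by (intro prod_mono) auto
  ultimately have "real (m - r) ^ r \<le> real (m choose r) * fact r" by simp
  moreover have "real m ^ r / 2 \<le> real (m - r) ^ r"
  proof -
    have "1 + real r * (- (1 / (2 * r))) \<le> (1 + - (1 / (2 * r))) ^ r"
      using assms by (intro Bernoulli_inequality) (simp add: field_simps)
    then have "1 / 2 \<le> (1 - 1 / (2 * real r)) ^ r" using assms by simp
    then have "real m ^ r * (1 / 2) \<le> real m ^ r * (1 - 1 / (2 * real r)) ^ r"
      by (intro mult_left_mono) auto
    also have "\<dots> = (real m * (1 - 1 / (2 * real r))) ^ r" by (simp add: power_mult_distrib)
    also have "real m * (1 - 1 / (2 * real r)) = real (m - r)"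
      using assms rm by (simp add: of_nat_diff m_def field_simps power2_eq_square)
    finally show ?thesis by simp
  qed
  ultimately show ?thesis unfolding m_def by linarith
qed

section \<open>Choice of the parameters\<close>

theorem theorem1p2:
  shows "\<exists>c::real. c > 0 \<and> (\<exists>r0::nat. \<forall>r\<ge>r0. \<forall>H :: nat hypergraph.
           is_H3 r H \<longrightarrow> turan_density r H \<ge> c * sqrt (ln (real r)) / (real r)\<^sup>2)"
proof (intro exI[of _ "1/4096 :: real"] exI[of _ "256 :: nat"] conjI allI impI)
  show "(0::real) < 1/4096" by simp
  fix r :: nat and H :: "nat hypergraph"
  assume r: "256 \<le> r" and H: "is_H3 r H"
  define m where "m = 2 * r ^ 2"
  \<comment> \<open>Few corners require \<open>r ^ 7 * q ^ 4\<close> to be small, so an exponent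
    below -7/4, which also controls overlaps. For \<open>ln d\<close> to have order
    \<open>ln r\<close>, \<open>r ^ 4 * q ^ 2\<close> must be a positive power of \<open>r\<close>,
    so the exponent must exceed -2; the midpoint is -15/8.\<close>
  define q where "q = real r powr (-15/8)"
  define d where "d = 4 * (real m * real r ^ 2 * q ^ 2)"
  have r0: "0 < r" "0 < m" "1 \<le> real r" using r by (auto simp: m_def)
  have q: "0 < q" "q \<le> 1" using r0 powr_mono[of "-15/8" 0 "real r"] by (simp_all add: q_def)
  have pow: "real r ^ a * q ^ b = real r powr (a - 15/8 * b)" for a b :: nat
    using r0 by (simp add: q_def powr_realpow[symmetric] powr_powr powr_add[symmetric] mult.commute flip: powr_power)
  \<comment> \<open>The threshold 256 is where \<open>4 * r powr (-1/2)\<close>, the bound for the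
    corners, reaches 1/4.\<close>
  have small: "real r powr (-1/2) \<le> 1/16"
  proof -
    have "(16::real) = 256 powr (1/2)" by (simp add: powr_half_sqrt)
    also have "\<dots> \<le> real r powr (1/2)" using r by (intro powr_mono2) auto
    finally show ?thesis by (simp add: powr_minus divide_simps)
  qed
  have q3: "real m * real r ^ 3 * q ^ 3 \<le> 1/4"
  proof -
    have "real m * real r ^ 3 * q ^ 3 = 2 * (real r ^ 5 * q ^ 3)" by (simp add: m_def flip: power_add)
    also have "real r ^ 5 * q ^ 3 = real r powr (-5/8)" unfolding pow by simp
    also have "\<dots> \<le> real r powr (-1/2)" using r0 by (intro powr_mono) auto
    finally show ?thesis using small by linarith
  qed
  have q4: "real m ^ 2 * real r ^ 3 * q ^ 4 \<le> 1/4"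
  proof -
    have "real m ^ 2 * real r ^ 3 * q ^ 4 = 4 * (real r ^ 7 * q ^ 4)"
      by (simp add: m_def power_mult_distrib flip: power_add power_mult)
    also have "real r ^ 7 * q ^ 4 = real r powr (-1/2)" unfolding pow by simp
    finally show ?thesis using small by linarith
  qed
  have d_r: "d = 8 * (real r ^ 4 * q ^ 2)"
    by (simp add: d_def m_def flip: power_add)
  also have "real r ^ 4 * q ^ 2 = real r powr (1/4)" unfolding pow by simp
  finally have d: "d = 8 * real r powr (1/4)" .
  have d_ge: "real r powr (1/4) \<le> d" "1 \<le> real r powr (1/4)"
    using r0 ge_one_powr_ge_zero[of "real r" "1/4"] by (simp_all add: d)
  have X: "finite {..<m}" "card {..<m} = m" by auto
  obtain I where I: "\<And>A. A \<in> I \<Longrightarrow> A \<subseteq> {..<m} \<and> card A = r"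
    "\<And>W A B C. \<lbrakk>card W = Suc r; {A, B, C} \<subseteq> I; A \<subseteq> W; B \<subseteq> W; C \<subseteq> W;
      A \<noteq> B; A \<noteq> C; B \<noteq> C\<rbrakk> \<Longrightarrow> False"
    and I_ge: "sqrt (ln d / d) * q * (m choose r) / 256 \<le> card I"
  proof (rule exists_H3_free_family[OF X r0(2,1) q q3 q4])
    show "1 \<le> d" using d_ge by linarith
    show "d = 4 * (real m * real r ^ 2 * q ^ 2)" by (simp add: d_def)
  qed blast
  \<comment> \<open>As \<open>d\<close> is proportional to \<open>q ^ 2\<close>, the factor
    \<open>q\<close> cancels and \<open>ln d / (8 * r ^ 4)\<close> remains under the root. Weakening
    32 to the square 36 keeps the constant rational.\<close>
  have "sqrt (ln r) / (6 * real r ^ 2) \<le> sqrt (ln d / d) * q"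
  proof -
    have "ln r / 4 = ln (real r powr (1/4))" using r0 by (simp add: ln_powr)
    also have "\<dots> \<le> ln d" using d_ge by (subst ln_le_cancel_iff) linarith+
    finally have ln: "ln r / 4 \<le> ln d" .
    have "ln r / (36 * real r ^ 4) \<le> ln r / (32 * real r ^ 4)"
      using r0 by (intro divide_left_mono) auto
    also have "\<dots> = ln r / 4 / (8 * real r ^ 4)" by simp
    also have "\<dots> \<le> ln d / (8 * real r ^ 4)" using ln by (intro divide_right_mono) auto
    also have "\<dots> = ln d / d * q ^ 2" using q r0 by (simp add: d_r)
    finally have "sqrt (ln r / (36 * real r ^ 4)) \<le> sqrt (ln d / d * q ^ 2)"
      by (rule real_sqrt_le_mono)
    moreover have "sqrt (ln d / d * q ^ 2) = sqrt (ln d / d) * q"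
      using q by (subst real_sqrt_mult) simp
    moreover have "36 * real r ^ 4 = (6 * real r ^ 2) ^ 2" by (simp add: power_mult_distrib flip: power_mult)
    then have "sqrt (36 * real r ^ 4) = 6 * real r ^ 2" by (intro real_sqrt_unique) auto
    then have "sqrt (ln r / (36 * real r ^ 4)) = sqrt (ln r) / (6 * real r ^ 2)"
      by (simp add: real_sqrt_divide)
    ultimately show ?thesis by simp
  qed
  then have "sqrt (ln r) / (6 * real r ^ 2) * ((m choose r) / 256) \<le> sqrt (ln d / d) * q * ((m choose r) / 256)"
    by (intro mult_right_mono) auto
  also have "\<dots> \<le> card I" using I_ge by simp
  finally have I_ge': "sqrt (ln r) / (1536 * real r ^ 2) * (m choose r) \<le> card I" by simp
  \<comment> \<open>Here \<open>1536 = 6 * 256\<close>; the factor 1/2 from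
    \<open>binomial_fact_ge\<close> turns it into 3072, which 4096 exceeds.\<close>
  have "1/4096 * sqrt (ln r) / real r ^ 2 \<le> sqrt (ln r) / (1536 * real r ^ 2) * (1/2)"
    using r0 by (simp add: field_simps)
  also have "\<dots> \<le> sqrt (ln r) / (1536 * real r ^ 2) * (real (m choose r) * fact r / m ^ r)"
  proof (intro mult_left_mono)
    show "1/2 \<le> real (m choose r) * fact r / m ^ r"
      using binomial_fact_ge[OF r0(1)] r0 by (simp add: m_def field_simps)
  qed (use r0 in simp)
  also have "\<dots> = (sqrt (ln r) / (1536 * real r ^ 2) * (m choose r)) * (fact r / m ^ r)" by simp
  also have "\<dots> \<le> card I * (fact r / m ^ r)"
    using I_ge' by (intro mult_right_mono) auto
  also have "\<dots> = card I * fact r / m ^ r" by simp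
  also have "\<dots> \<le> turan_density r H"
  proof (rule turan_density_H3_ge[OF H _ r0(2)])
    show "2 \<le> r" using r by simp
    show "A \<subseteq> {..<m} \<and> card A = r" if "A \<in> I" for A using I(1)[OF that] .
  qed (rule I(2))
  finally show "1/4096 * sqrt (ln (real r)) / (real r)\<^sup>2 \<le> turan_density r H" .
qed

end
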